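(* Let $\alpha=e^{2\pi i/3}$, and let $\Gamma_0,\Gamma^+,\Gamma^-$ and the functionals $F_\lambda$ for Problem 1 and Problem 2 be as in the context, with inverse transform $f_x(F)=\left\{\int_{\Gamma_0}+\int_{\Gamma^+}+\int_{\Gamma^-}\right\}e^{i\lambda x}F(\lambda)\,d\lambda$. (1) Let $F_\lambda$ be the functionals of Problem 1. For all $f\in C^\infty[0,1]$ such that $f(0)=f(1)=0$ and $f'(0)=2f'(1)$, and for all $x\in(0,1)$, $f_x(F_\lambda(f))=f(x)$. (2) Let $F_\lambda$ be the functionals of Problem 2. For all $f\in C^\infty[0,1]$ such that $f(0)=f(1)=f'(1)=0$, and for all $x\in(0,1)$, $f_x(F_\lambda(f))=f(x)$.
   Context: **Contours.** $\mathbb C^{\pm}$ are the open upper/lower half-planes. $\Gamma_0$ is the circle of radius $\tfrac12$ centred at $0$; $\Gamma^\pm$ is the boundary of $\{\lambda\in\mathbb C^\pm:\operatorname{Im}(\lambda^3)>0,\ |\lambda|>1\}$. Each contour is oriented so that the enclosed region (the disc, respectively the stated domain) lies to its left. Integrals along infinite contours are understood as improper integrals. **Functionals.** $$F_\lambda(f)=\begin{cases}\int_0^1\phi^+(x,\lambda)f(x)\,dx,&\lambda\in\Gamma^+\cup\Gamma_0,\\ \int_0^1\phi^-(x,\lambda)f(x)\,dx,&\lambda\in\Gamma^-,\end{cases}$$ where, for Problem 1, $\Delta(\lambda)=e^{i\lambda}+\alpha e^{i\alpha\lambda}+\alpha^2e^{i\alpha^2\lambda}+2(e^{-i\lambda}+\alpha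 e^{-i\alpha\lambda}+\alpha^2e^{-i\alpha^2\lambda})$ and $$\phi^+(x,\lambda)=\tfrac{1}{2\pi\Delta(\lambda)}\big[e^{-i\lambda x}(e^{i\lambda}+2\alpha e^{-i\alpha\lambda}+2\alpha^2e^{-i\alpha^2\lambda})+e^{-i\alpha\lambda x}(\alpha e^{i\alpha\lambda}-2\alpha e^{-i\lambda})+e^{-i\alpha^2\lambda x}(\alpha^2e^{i\alpha^2\lambda}-2\alpha^2e^{-i\lambda})\big],$$ $$\phi^-(x,\lambda)=\tfrac{-e^{-i\lambda}}{2\pi\Delta(\lambda)}\big[e^{-i\lambda x}(2+\alpha^2e^{-i\alpha\lambda}+\alpha e^{-i\alpha^2\lambda})+\alpha e^{-i\alpha\lambda x}(2-e^{-i\alpha^2\lambda})+\alpha^2e^{-i\alpha^2\lambda x}(2-e^{-i\alpha\lambda})\big];$$ and, for Problem 2, $\Delta(\lambda)=e^{-i\lambda}+\alpha e^{-i\alpha\lambda}+\alpha^2e^{-i\alpha^2\lambda}$ and $$\phi^+(x,\lambda)=\tfrac{1}{2\pi\Delta(\lambda)}\big[e^{-i\lambda x}(\alpha e^{-i\alpha\lambda}+\alpha^2e^{-i\alpha^2\lambda})-(\alpha e^{-i\alpha\lambda x}+\alpha^2e^{-i\alpha^2\lambda x})e^{-i\lambda}\big],$$ $$\phi^-(x,\lambda)=\tfrac{-e^{-i\lambda}}{2\pi\Delta(\lambda)}\big[e^{-i\lambda x}+\alpha e^{-i\alpha\lambda x}+\alpha^2e^{-i\alpha^2\lambda x}\big].$$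 *)

theory Defs
  imports "HOL-Complex_Analysis.Complex_Analysis"
begin

section \<open>Smooth functions on the closed unit interval\<close>

text \<open>Derivatives are taken within \<open>[0,1]\<close>, hence one-sided at the endpoints; the values of
  \<open>f\<close> outside \<open>[0,1]\<close> play no role.\<close>

definition deriv01 :: "(real \<Rightarrow> complex) \<Rightarrow> real \<Rightarrow> complex" where
  "deriv01 f t = vector_derivative f (at t within {0..1})"

definition smooth01 :: "(real \<Rightarrow> complex) \<Rightarrow> bool" where
  "smooth01 f \<longleftrightarrow> (\<forall>n. ((deriv01 ^^ n) f) differentiable_on {0..1})"


section \<open>Contours\<close>

definition Gamma0 :: "complex set" where
  "Gamma0 = sphere 0 (1/2)"

definition Gamma_plus :: "complex set" where
  "Gamma_plus = frontier {z. Im z > 0 \<and> Im (z ^ 3) > 0 \<and> norm z > 1}"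

definition Gamma_minus :: "complex set" where
  "Gamma_minus = frontier {z. Im z < 0 \<and> Im (z ^ 3) > 0 \<and> norm z > 1}"

text \<open>The improper integral of \<open>g\<close> along the ray from \<open>cis \<theta>\<close> to infinity, oriented outwards.\<close>

definition has_ray_integral ::
    "(complex \<Rightarrow> complex) \<Rightarrow> real \<Rightarrow> complex \<Rightarrow> bool" where
  "has_ray_integral g \<theta> I \<longleftrightarrow>
     (\<forall>R>1. g contour_integrable_on linepath (cis \<theta>) (of_real R * cis \<theta>)) \<and>
     ((\<lambda>R. contour_integral (linepath (cis \<theta>) (of_real R * cis \<theta>)) g) \<longlongrightarrow> I) at_top"

text \<open>The integral along the boundary of the truncated sector
  \<open>{r * cis \<theta> | r \<theta>. 1 < r \<and> a < \<theta> \<and> \<theta> < b}\<close>, with the sector on the left: inwards along the ray of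
  argument \<open>b\<close>, clockwise along the unit arc from \<open>cis b\<close> to \<open>cis a\<close>, and outwards along the ray of
  argument \<open>a\<close>.\<close>

definition has_sector_boundary_integral ::
    "(complex \<Rightarrow> complex) \<Rightarrow> real \<Rightarrow> real \<Rightarrow> complex \<Rightarrow> bool" where
  "has_sector_boundary_integral g a b I \<longleftrightarrow>
     (\<exists>J_in J_arc J_out.
        has_ray_integral g b J_in \<and>
        (g has_contour_integral J_arc) (part_circlepath 0 1 b a) \<and>
        has_ray_integral g a J_out \<and>
        I = - J_in + J_arc + J_out)"

text \<open>For \<open>z = r * cis \<theta>\<close> with \<open>r > 0\<close> the condition \<open>Im (z ^ 3) > 0\<close> means \<open>sin (3 * \<theta>) > 0\<close>.
  Hence the domain bounded by \<^const>\<open>Gamma_plus\<close> consists of the two sectors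
  \<open>0 < \<theta> < \<pi>/3\<close> and \<open>2\<pi>/3 < \<theta> < \<pi>\<close>, and the one bounded by \<^const>\<open>Gamma_minus\<close> of the single
  sector \<open>4\<pi>/3 < \<theta> < 5\<pi>/3\<close>, each cut off at the unit circle.\<close>

definition has_Gamma_plus_integral :: "(complex \<Rightarrow> complex) \<Rightarrow> complex \<Rightarrow> bool" where
  "has_Gamma_plus_integral g I \<longleftrightarrow>
     (\<exists>I1 I2. has_sector_boundary_integral g 0 (pi/3) I1 \<and>
              has_sector_boundary_integral g (2*pi/3) pi I2 \<and>
              I = I1 + I2)"

definition has_Gamma_minus_integral :: "(complex \<Rightarrow> complex) \<Rightarrow> complex \<Rightarrow> bool" where
  "has_Gamma_minus_integral g I \<longleftrightarrow> has_sector_boundary_integral g (4*pi/3) (5*pi/3) I"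

text \<open>\<open>has_inverse_transform F x y\<close>: all integrals defining the inverse transform of \<open>F\<close>
  at \<open>x\<close> exist, and their sum is \<open>y\<close>.\<close>

definition has_inverse_transform :: "(complex \<Rightarrow> complex) \<Rightarrow> real \<Rightarrow> complex \<Rightarrow> bool" where
  "has_inverse_transform F x y \<longleftrightarrow>
     (let g = (\<lambda>z. exp (\<i> * z * of_real x) * F z) in
      \<exists>I0 Iplus Iminus. (g has_contour_integral I0) (circlepath 0 (1/2)) \<and>
                 has_Gamma_plus_integral g Iplus \<and>
                 has_Gamma_minus_integral g Iminus \<and>
                 y = I0 + Iplus + Iminus)"


section \<open>The functionals\<close>

text \<open>The spectral parameter is written \<open>z\<close>, since \<open>\<lambda>\<close> is reserved for abstraction.\<close>

definition alpha :: complex where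
  "alpha = exp (2 * of_real pi * \<i> / 3)"

text \<open>The three contours are pairwise disjoint, so the order of the cases is irrelevant; off the
  contours the value is arbitrary.\<close>

definition functional ::
    "(real \<Rightarrow> complex \<Rightarrow> complex) \<Rightarrow> (real \<Rightarrow> complex \<Rightarrow> complex) \<Rightarrow>
     (real \<Rightarrow> complex) \<Rightarrow> complex \<Rightarrow> complex" where
  "functional \<phi>p \<phi>m f z =
     (if z \<in> Gamma_plus \<union> Gamma0 then integral {0..1} (\<lambda>x. \<phi>p x z * f x)
      else if z \<in> Gamma_minus then integral {0..1} (\<lambda>x. \<phi>m x z * f x)
      else undefined)"

subsection \<open>Problem 1\<close>

definition Delta1 :: "complex \<Rightarrow> complex" where
  "Delta1 z = exp (\<i> * z) + alpha * exp (\<i> * alpha * z) + alpha^2 * exp (\<i> * alpha^2 * z)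
     + 2 * (exp (- \<i> * z) + alpha * exp (- \<i> * alpha * z) + alpha^2 * exp (- \<i> * alpha^2 * z))"

definition phi1_plus :: "real \<Rightarrow> complex \<Rightarrow> complex" where
  "phi1_plus x z = 1 / (2 * of_real pi * Delta1 z) *
     (exp (- \<i> * z * of_real x) *
        (exp (\<i> * z) + 2 * alpha * exp (- \<i> * alpha * z) + 2 * alpha^2 * exp (- \<i> * alpha^2 * z))
      + exp (- \<i> * alpha * z * of_real x) *
        (alpha * exp (\<i> * alpha * z) - 2 * alpha * exp (- \<i> * z))
      + exp (- \<i> * alpha^2 * z * of_real x) *
        (alpha^2 * exp (\<i> * alpha^2 * z) - 2 * alpha^2 * exp (- \<i> * z)))"

definition phi1_minus :: "real \<Rightarrow> complex \<Rightarrow> complex" where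
  "phi1_minus x z = - exp (- \<i> * z) / (2 * of_real pi * Delta1 z) *
     (exp (- \<i> * z * of_real x) *
        (2 + alpha^2 * exp (- \<i> * alpha * z) + alpha * exp (- \<i> * alpha^2 * z))
      + alpha * exp (- \<i> * alpha * z * of_real x) * (2 - exp (- \<i> * alpha^2 * z))
      + alpha^2 * exp (- \<i> * alpha^2 * z * of_real x) * (2 - exp (- \<i> * alpha * z)))"

definition F1 :: "(real \<Rightarrow> complex) \<Rightarrow> complex \<Rightarrow> complex" where
  "F1 = functional phi1_plus phi1_minus"

subsection \<open>Problem 2\<close>

definition Delta2 :: "complex \<Rightarrow> complex" where
  "Delta2 z = exp (- \<i> * z) + alpha * exp (- \<i> * alpha * z) + alpha^2 * exp (- \<i> * alpha^2 * z)"

definition phi2_plus :: "real \<Rightarrow> complex \<Rightarrow> complex" where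
  "phi2_plus x z = 1 / (2 * of_real pi * Delta2 z) *
     (exp (- \<i> * z * of_real x) *
        (alpha * exp (- \<i> * alpha * z) + alpha^2 * exp (- \<i> * alpha^2 * z))
      - (alpha * exp (- \<i> * alpha * z * of_real x)
         + alpha^2 * exp (- \<i> * alpha^2 * z * of_real x)) * exp (- \<i> * z))"

definition phi2_minus :: "real \<Rightarrow> complex \<Rightarrow> complex" where
  "phi2_minus x z = - exp (- \<i> * z) / (2 * of_real pi * Delta2 z) *
     (exp (- \<i> * z * of_real x)
      + alpha * exp (- \<i> * alpha * z * of_real x)
      + alpha^2 * exp (- \<i> * alpha^2 * z * of_real x))"

definition F2 :: "(real \<Rightarrow> complex) \<Rightarrow> complex \<Rightarrow> complex" where
  "F2 = functional phi2_plus phi2_minus"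

end

theory Submission
  imports Defs
begin

text \<open>
  Write \<open>g\<^sup>+ = e^(i\<lambda>x) F\<^sup>+\<close> and \<open>g\<^sup>- = e^(i\<lambda>x) F\<^sup>-\<close> for the two integrands. The zeros of \<open>\<Delta>\<close> other
  than \<open>0\<close> lie inside the domains bounded by the contours, and outside these domains \<open>g\<^sup>+\<close> (in the
  upper half-plane) and \<open>g\<^sup>-\<close> (in the lower) are \<open>O(|\<lambda>|^(-2))\<close>, because \<open>f\<close> vanishes at the
  endpoints. Hence the sloping rays can be rotated onto the real axis, at the cost of arcs of the unit circle.
  Since \<open>g\<^sup>+ - g\<^sup>- = e^(i\<lambda>x) f^(\<lambda>) / 2\<pi>\<close>, with \<open>f^\<close> the Fourier transform of \<open>f\<close>, the total is the
  difference of the integrals of \<open>g\<^sup>+\<close> over the circles of radius \<open>1/2\<close> and \<open>1\<close>, which vanishes,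
  plus the Fourier integral along the real axis indented below the origin. The latter is split at \<open>x\<close>: the
  part from \<open>[0,x]\<close> is closed in the upper and the part from \<open>[x,1]\<close> in the lower half-plane, and
  each contributes \<open>f(x)/2\<close> through its leading term \<open>\<mp>f(x)/(2\<pi>i\<lambda>)\<close> at infinity.
\<close>

section \<open>The characteristic functions\<close>

lemma alpha_cis: "alpha = cis (2 * pi / 3)" "alpha^2 = cis (4 * pi / 3)"
proof -
  show *: "alpha = cis (2 * pi / 3)"
    by (simp add: alpha_def cis_conv_exp mult_ac)
  show "alpha^2 = cis (4 * pi / 3)"
    unfolding * Complex.DeMoivre by simp
qed

lemma alpha_eq: "alpha = Complex (-1/2) (sqrt 3 / 2)"
  by (simp add: alpha_cis(1) complex_eq_iff cos_120 sin_120)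

lemma alpha_squared: "alpha^2 = Complex (-1/2) (- sqrt 3 / 2)"
  by (simp add: alpha_eq power2_eq_square complex_eq_iff)

lemma alpha_cubed: "alpha^3 = 1"
  using alpha_squared by (simp add: alpha_eq power3_eq_cube power2_eq_square complex_eq_iff)

lemma alpha_sum: "1 + alpha + alpha^2 = 0"
  unfolding alpha_squared by (simp add: alpha_eq complex_eq_iff)

lemma norm_alpha [simp]: "norm alpha = 1"
  by (simp add: alpha_def)

text \<open>Orthogonality of the cube roots of unity. The exponent is \<open>k + 1\<close> because
  in \<open>exp3\<close> the term of degree \<open>k\<close> carries \<open>alpha^k\<close> from the
  argument and one more \<open>alpha\<close> from the coefficient.\<close>

lemma alpha_power_sum: "1 + alpha^(k+1) + alpha^(2*(k+1)) = (if k mod 3 = 2 then 3 else 0)"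
proof -
  have "k mod 3 = 0 \<or> k mod 3 = 1 \<or> k mod 3 = 2" by linarith
  then obtain m where "k = 3 * m \<or> k = 3 * m + 1 \<or> k = 3 * m + 2"
    by (metis add.right_neutral div_mult_mod_eq mult.commute)
  moreover have p: "alpha^(3 * n + j) = alpha^j" for n j
    by (simp add: power_add power_mult alpha_cubed)
  ultimately show ?thesis
  proof (elim disjE)
    assume "k = 3 * m"
    then have "k mod 3 = 0" "k + 1 = 3 * m + 1" "2 * (k+1) = 3 * (2 * m) + 2" by simp_all
    then show ?thesis using alpha_sum by (simp only: p) simp
  next
    assume "k = 3 * m + 1"
    then have "k mod 3 = 1" "k + 1 = 3 * m + 2" "2 * (k+1) = 3 * (2 * m + 1) + 1" by presburger+
    then show ?thesis using alpha_sum by (simp only: p) (simp add: add_ac)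
  next
    assume "k = 3 * m + 2"
    then have "k mod 3 = 2" "k + 1 = 3 * (m + 1) + 0" "2 * (k+1) = 3 * (2 * m + 2) + 0" by presburger+
    then show ?thesis by (simp only: p) simp
  qed
qed

text \<open>The trailing factor \<open>z\<close> lets these rules act on right-nested products,
  where \<open>alpha^3\<close> does not occur as a subterm.\<close>

lemma alpha_mult [simp]: "alpha * (alpha * z) = alpha^2 * z" "alpha * (alpha^2 * z) = z"
   "alpha^2 * (alpha * z) = z" "alpha^2 * (alpha^2 * z) = alpha * z"
proof -
  have "alpha * alpha^2 = alpha^3" "alpha^2 * alpha^2 = alpha * alpha^3"
    by (simp_all add: power2_eq_square power3_eq_cube)
  then have *: "alpha * alpha^2 = 1" "alpha^2 * alpha^2 = alpha"
    by (simp_all add: alpha_cubed)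
  show "alpha * (alpha * z) = alpha^2 * z" "alpha * (alpha^2 * z) = z"
   "alpha^2 * (alpha * z) = z" "alpha^2 * (alpha^2 * z) = alpha * z"
    using * by (simp_all add: power2_eq_square mult.assoc[symmetric])
qed

lemma alpha_sum_mult: "z + alpha * z + alpha^2 * z = 0"
  using alpha_sum by (metis distrib_right mult_1 mult_zero_left)

lemma Im_alpha_sum: "Im (alpha * z) + Im (alpha^2 * z) = - Im z"
  using arg_cong[OF alpha_sum_mult[of z], of Im] by simp

text \<open>The solution of y''' = y with y(0) = y'(0) = 0 and y''(0) = 3, a third-order analogue of
  the hyperbolic functions. Both characteristic functions are built from it.\<close>

definition exp3 :: "complex \<Rightarrow> complex" where
  "exp3 w = exp w + alpha * exp (alpha * w) + alpha^2 * exp (alpha^2 * w)"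

text \<open>Rotation by \<open>alpha\<close> permutes the three exponentials cyclically; restoring
  their coefficients costs the factor \<open>alpha^2\<close>.\<close>

lemma exp3_alpha: "exp3 (alpha * w) = alpha^2 * exp3 w"
  unfolding exp3_def distrib_left alpha_mult by (simp add: add_ac mult.assoc)

text \<open>Only the powers \<open>w^k\<close> with \<open>k mod 3 = 2\<close> survive in the Taylor series of \<^const>\<open>exp3\<close>.\<close>

lemma exp3_Taylor:
  assumes "w \<noteq> 0" "norm w \<le> 2"
  shows "norm (exp3 w - 3 / 2 * w^2) < 3 / 2 * norm w ^ 2"
proof -
  \<comment> \<open>Degree 7 retains the powers 2 and 5; the next surviving power is 8, which is the
    order of the remainder.\<close>
  define p where "p = (\<lambda>w::complex. \<Sum>k\<le>7. w ^ k / fact k)"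
  have sum8: "(\<Sum>k\<le>7. g k) = g 0 + g 1 + g 2 + g 3 + g 4 + g 5 + g 6 + g 7" for g :: "nat \<Rightarrow> complex"
    by (simp add: eval_nat_numeral)
  have p3: "p w + alpha * p (alpha * w) + alpha^2 * p (alpha^2 * w) = 3 / 2 * w^2 + w^5 / 40"
  proof -
    have "p w + alpha * p (alpha * w) + alpha^2 * p (alpha^2 * w)
        = (\<Sum>k\<le>7. (1 + alpha^(k+1) + alpha^(2*(k+1))) * (w ^ k / fact k))"
      unfolding p_def sum_distrib_left sum.distrib[symmetric]
    proof (intro sum.cong refl)
      fix k :: nat
      have *: "alpha^(2*(k+1)) = alpha^2 * (alpha^2)^k"
        by (simp only: power_mult power_Suc flip: Suc_eq_plus1)
      show "w^k / fact k + alpha * ((alpha * w)^k / fact k) + alpha^2 * ((alpha^2 * w)^k / fact k)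
          = (1 + alpha^(k+1) + alpha^(2*(k+1))) * (w^k / fact k)"
        unfolding * by (simp add: power_mult_distrib add_divide_distrib algebra_simps)
    qed
    also have "\<dots> = (\<Sum>k\<le>7. (if k mod 3 = 2 then 3 else 0) * (w ^ k / fact k))"
      by (intro sum.cong refl arg_cong2[of _ _ _ _ "(*)"] alpha_power_sum)
    also have "\<dots> = 3 / 2 * w^2 + w^5 / 40"
      unfolding sum8 by (simp add: fact_numeral)
    finally show ?thesis .
  qed
  define r where "r = norm w"
  have r: "0 < r" "r \<le> 2" using assms by (auto simp: r_def)
  have e: "norm (exp u - p u) \<le> r ^ 8 / 560" if "norm u = r" for u
  proof -
    \<comment> \<open>The Taylor remainder carries the factor exp |Re u| / 7!. Here |Re u| is at
      most 2, so e \<le> 3 gives 9 / 5040 = 1 / 560.\<close>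
    have "exp \<bar>Re u\<bar> \<le> exp (1+1::real)"
      using abs_Re_le_cmod[of u] that r by simp
    also have "\<dots> = exp 1 * exp 1" by (rule exp_add)
    also have "\<dots> \<le> 3 * 3" by (intro mult_mono exp_le) auto
    finally have "exp \<bar>Re u\<bar> * r ^ 8 / 5040 \<le> 9 * r^8 / 5040"
      by (intro divide_right_mono mult_right_mono) auto
    then show ?thesis
      using Taylor_exp[of u 7] that by (simp add: p_def fact_numeral)
  qed
  have "exp3 w - 3 / 2 * w^2 = (exp w - p w) + alpha * (exp (alpha * w) - p (alpha * w))
          + alpha^2 * (exp (alpha^2 * w) - p (alpha^2 * w)) + w^5 / 40"
    using p3 by (simp add: exp3_def algebra_simps)
  also have "norm \<dots> \<le> r^8 / 560 + r^8 / 560 + r^8 / 560 + r^5 / 40"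
    using e[of w] e[of "alpha * w"] e[of "alpha^2 * w"]
    by (intro norm_triangle_le add_mono)
       (auto simp: norm_mult norm_power norm_divide r_def)
  also have "\<dots> = r^2 * (3 * r^6 / 560 + r^3 / 40)"
    by (simp add: field_simps eval_nat_numeral)
  \<comment> \<open>The bracket increases with \<open>r\<close>; at r = 2 it is about 0.54, well
    below 3/2.\<close>
  also have "\<dots> \<le> r^2 * (3 * 2^6 / 560 + 2^3 / 40)"
    using r by (intro mult_left_mono add_mono divide_right_mono power_mono) auto
  also have "\<dots> < r^2 * (3/2)"
    using r by (intro mult_strict_left_mono) auto
  finally show ?thesis by (simp add: r_def mult.commute)
qed

section \<open>Zeros near the origin and rotational symmetry of the characteristic functions\<close>

lemma Delta1_exp3: "Delta1 z = exp3 (\<i> * z) + 2 * exp3 (- \<i> * z)"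
  by (simp add: Delta1_def exp3_def mult_ac)

lemma Delta2_exp3: "Delta2 z = exp3 (- \<i> * z)"
  by (simp add: Delta2_def exp3_def mult_ac)

text \<open>The quadratic parts add up to -9/2 z^2. The remainders, with weights 1 and 2, stay
  strictly below 3/2 + 3 = 9/2 times |z|^2 and cannot cancel them. Radius 2 covers the circles of
  radius 1/2 and 1 and reaches the range of the bounds for large \<open>z\<close>.\<close>

lemma Delta1_nonzero_disc:
  assumes "z \<noteq> 0" "norm z \<le> 2"
  shows "Delta1 z \<noteq> 0"
proof
  assume "Delta1 z = 0"
  then have "(exp3 (\<i> * z) - 3 / 2 * (\<i> * z)^2) + 2 * (exp3 (- \<i> * z) - 3 / 2 * (- \<i> * z)^2) = 9 / 2 * z^2"
    by (simp add: Delta1_exp3 power_mult_distrib right_diff_distrib add_eq_0_iff2)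
  then have "norm (9 / 2 * z^2) = norm ((exp3 (\<i> * z) - 3 / 2 * (\<i> * z)^2) + 2 * (exp3 (- \<i> * z) - 3 / 2 * (- \<i> * z)^2))"
    by (simp only:)
  then have "9 / 2 * norm z ^ 2 = norm ((exp3 (\<i> * z) - 3 / 2 * (\<i> * z)^2) + 2 * (exp3 (- \<i> * z) - 3 / 2 * (- \<i> * z)^2))"
    by (simp only: norm_mult norm_power norm_divide norm_numeral)
  also have "\<dots> \<le> norm (exp3 (\<i> * z) - 3 / 2 * (\<i> * z)^2) + 2 * norm (exp3 (- \<i> * z) - 3 / 2 * (- \<i> * z)^2)"
    by (metis norm_mult norm_numeral norm_triangle_ineq)
  also have "\<dots> < 3 / 2 * norm z ^ 2 + 2 * (3 / 2 * norm z ^ 2)"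
    using exp3_Taylor[of "\<i> * z"] exp3_Taylor[of "- \<i> * z"] assms
    by (intro add_strict_mono) (auto simp: norm_mult)
  finally show False by simp
qed

lemma Delta2_nonzero_disc:
  assumes "z \<noteq> 0" "norm z \<le> 2"
  shows "Delta2 z \<noteq> 0"
  using exp3_Taylor[of "- \<i> * z"] assms
  by (auto simp: Delta2_exp3 norm_mult norm_power power_mult_distrib)

text \<open>The factor \<open>alpha^2\<close> has modulus 1, so non-vanishing and lower bounds pass
  from \<open>sector\<close> to its rotations.\<close>

lemma Delta1_alpha: "Delta1 (alpha * z) = alpha^2 * Delta1 z"
  using exp3_alpha[of "\<i> * z"] exp3_alpha[of "- \<i> * z"]
  by (simp add: Delta1_exp3 mult.left_commute distrib_left)

lemma Delta2_alpha: "Delta2 (alpha * z) = alpha^2 * Delta2 z"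
  using exp3_alpha[of "- \<i> * z"] by (simp add: Delta2_exp3 mult.left_commute)

text \<open>The set \<open>\<pi>/3 \<le> arg z \<le> 2\<pi>/3\<close>, with the double zero of \<open>\<Delta>\<close> at the origin cut off by a half-plane
  so that what remains is convex and still contains every point of the sector with \<open>1 \<le> |z|\<close>. Its
  rotations by powers of \<^const>\<open>alpha\<close> are the sectors outside the domains bounded by the contours.\<close>

definition sector :: "complex set" where
  "sector = {z. Im (alpha * z) \<le> 0 \<and> Im (alpha^2 * z) \<le> 0 \<and> 1 / 2 \<le> Im z}"

text \<open>In the sector sqrt 3 * |Re z| is at most Im z, which gives the sharp constant sqrt 3 in
  place of 17/10. The smaller rational number keeps the later arithmetic simple.\<close>

lemma norm_le_Im_sector:
  assumes "z \<in> sector"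
  shows "17 / 10 * norm z \<le> 2 * Im z"
proof -
  define x y where "x = Re z" and "y = Im z"
  have s: "sqrt 3 * x \<le> y" "- sqrt 3 * x \<le> y" "0 < y"
    using assms unfolding sector_def alpha_squared by (auto simp: alpha_eq x_def y_def field_simps)
  have "(sqrt 3 * x)^2 \<le> y^2"
    using s by (intro abs_le_square_iff[THEN iffD1]) (auto simp: abs_le_iff)
  then have "(17 / 10 * norm z)^2 \<le> (2 * y)^2"
    by (simp add: cmod_power2 x_def y_def power_mult_distrib power_divide)
       (use zero_le_power2[of "Im z"] in linarith)
  then have "17 / 10 * norm z \<le> 2 * y"
    by (rule power2_le_imp_le) (use s in simp)
  then show ?thesis by (simp add: y_def)
qed

text \<open>The first four terms of the exponential series at 17/10 sum to about 4.96. The value 4.8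
  leaves enough room for both lower bounds below.\<close>

lemma sector_exp_large:
  assumes "z \<in> sector" "2 \<le> norm z"
  shows "(96/20::real) \<le> exp (Im z)"
proof -
  have "17 / 10 \<le> Im z" using norm_le_Im_sector[OF assms(1)] assms(2) by simp
  then have "exp (17/10) \<le> exp (Im z)" by simp
  have "(\<Sum>k<4. inverse (fact k) *\<^sub>R (17/10::real)^k) \<le> exp (17/10)"
    unfolding exp_def by (intro sum_le_suminf summable_exp_generic) auto
  then have "(96/20::real) \<le> exp (17/10)" by (simp add: eval_nat_numeral)
  also note \<open>exp (17/10) \<le> exp (Im z)\<close>
  finally show ?thesis .
qed

text \<open>The dominant term is 2 exp(-iz), of modulus 2 exp(Im z). The terms with exponents
  \<open>b\<close> and \<open>c\<close> are not uniformly small against it, since either exponent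
  may be all of Im z = b + c at an edge of the sector; they have to be estimated jointly.\<close>

lemma Delta1_lower_sector:
  assumes "z \<in> sector" "2 \<le> norm z"
  shows "exp (Im z) / 8 \<le> norm (Delta1 z)"
proof -
  define b c where "b = - Im (alpha * z)" and "c = - Im (alpha^2 * z)"
  have a: "Im z = b + c" using Im_alpha_sum[of z] by (simp add: b_def c_def)
  have Im_bc: "Im (alpha * z) = - b" "Im (alpha^2 * z) = - c" by (simp_all add: b_def c_def)
  have bc: "0 \<le> b" "0 \<le> c" using assms by (auto simp: sector_def b_def c_def)
  have E: "(96/20::real) \<le> exp (b + c)" using sector_exp_large[OF assms] a by simp
  \<comment> \<open>Together the two growing secondary terms cost at most half of the dominant one,
    up to the constant 1.\<close>
  have "0 \<le> (exp b - 1) * (exp c - 1)" using bc by (intro mult_nonneg_nonneg) auto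
  then have bc': "exp b + exp c \<le> exp (b + c) + 1" by (simp add: exp_add algebra_simps)
  have "0 \<le> (1 - exp (-b)) * (1 - exp (-c))" using bc by (intro mult_nonneg_nonneg) auto
  then have bc'': "exp (-b) + exp (-c) \<le> exp (-b-c) + 1" by (simp add: algebra_simps flip: exp_add)
  have m: "exp (- b - c) \<le> 20/96" 
  proof -
    have "exp (- b - c) = inverse (exp (b + c))" by (simp add: exp_minus[symmetric])
    also have "\<dots> \<le> inverse (96/20)" using E by (intro le_imp_inverse_le) auto
    finally show ?thesis by simp
  qed
  have "2 * exp (- \<i> * z) = Delta1 z - (exp (\<i> * z) + alpha * exp (\<i> * alpha * z) + alpha^2 * exp (\<i> * alpha^2 * z)
     + (2 * alpha * exp (- \<i> * alpha * z) + 2 * alpha^2 * exp (- \<i> * alpha^2 * z)))"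
    by (simp add: Delta1_def algebra_simps)
  then have "norm (2 * exp (- \<i> * z)) \<le> norm (Delta1 z) + (norm (exp (\<i> * z)) + norm (alpha * exp (\<i> * alpha * z)) + norm (alpha^2 * exp (\<i> * alpha^2 * z))
     + (norm (2 * alpha * exp (- \<i> * alpha * z)) + norm (2 * alpha^2 * exp (- \<i> * alpha^2 * z))))"
    by (metis (no_types, lifting) norm_triangle_le_diff add_left_mono norm_triangle_le add_mono order_refl)
  then have "2 * exp (b + c) \<le> norm (Delta1 z) + (exp (-b-c) + exp b + exp c + (2 * exp (-b) + 2 * exp (-c)))"
    by (simp add: norm_mult norm_power a Im_bc mult.assoc add.commute del: times_complex.sel)
  then show ?thesis using bc' bc'' m E a by simp
qed

text \<open>Easier than for Problem 1: apart from the dominant exp(-iz) both terms have modulus at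
  most 1.\<close>

lemma Delta2_lower_sector:
  assumes "z \<in> sector" "2 \<le> norm z"
  shows "exp (Im z) / 8 \<le> norm (Delta2 z)"
proof -
  have bc: "Im (alpha * z) \<le> 0" "Im (alpha^2 * z) \<le> 0" using assms by (auto simp: sector_def)
  have E: "(96/20::real) \<le> exp (Im z)" using sector_exp_large[OF assms] .
  have "exp (- \<i> * z) = Delta2 z - (alpha * exp (- \<i> * alpha * z) + alpha^2 * exp (- \<i> * alpha^2 * z))"
    by (simp add: Delta2_def algebra_simps)
  then have "norm (exp (- \<i> * z)) \<le> norm (Delta2 z) + (norm (alpha * exp (- \<i> * alpha * z)) + norm (alpha^2 * exp (- \<i> * alpha^2 * z)))"
    by (metis (no_types, lifting) norm_triangle_le_diff add_left_mono norm_triangle_le add_mono order_refl)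
  also have "\<dots> = norm (Delta2 z) + (exp (Im (alpha * z)) + exp (Im (alpha^2 * z)))"
    by (simp add: norm_mult norm_power mult.assoc del: times_complex.sel)
  also have "\<dots> \<le> norm (Delta2 z) + (1 + 1)"
    using bc by (intro add_mono) auto
  finally show ?thesis using E by simp
qed

section \<open>Integrals along rays and arcs\<close>

abbreviation ray_integral :: "(complex \<Rightarrow> complex) \<Rightarrow> real \<Rightarrow> real \<Rightarrow> complex" where
  "ray_integral g \<theta> R \<equiv> contour_integral (linepath (cis \<theta>) (of_real R * cis \<theta>)) g"

abbreviation arc_integral :: "(complex \<Rightarrow> complex) \<Rightarrow> real \<Rightarrow> real \<Rightarrow> real \<Rightarrow> complex" where
  "arc_integral g r a b \<equiv> contour_integral (part_circlepath 0 r a b) g"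

definition ray :: "real \<Rightarrow> complex set" where
  "ray \<theta> = (\<lambda>r. of_real r * cis \<theta>) ` {1..}"

lemma rayI: "1 \<le> r \<Longrightarrow> of_real r * cis \<theta> \<in> ray \<theta>"
  by (auto simp: ray_def)

lemma linepath_ray:
  "linepath (of_real s * cis \<theta>) (of_real t * cis \<theta>) u = of_real (s + (t - s) * u) * cis \<theta>"
  by (simp add: linepath_def algebra_simps scaleR_conv_of_real)

lemma closed_segment_ray:
  assumes "1 \<le> s" "s \<le> t"
  shows "closed_segment (of_real s * cis \<theta>) (of_real t * cis \<theta>) \<subseteq> ray \<theta>"
proof -
  have "linepath (of_real s * cis \<theta>) (of_real t * cis \<theta>) u \<in> ray \<theta>" if "u \<in> {0..1}" for u
  proof -
    have "0 \<le> (t - s) * u" using assms that by simp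
    then show ?thesis unfolding linepath_ray using assms by (intro rayI) linarith
  qed
  then show ?thesis by (auto simp: path_image_def simp flip: path_image_linepath)
qed

lemma closed_segment_ray':
  assumes "1 \<le> t"
  shows "closed_segment (cis \<theta>) (of_real t * cis \<theta>) \<subseteq> ray \<theta>"
  using closed_segment_ray[of 1 t \<theta>] assms by simp

text \<open>The integrand is compared with C / r^2, whose primitive is -C / r.\<close>

lemma ray_piece_bound:
  assumes cont: "continuous_on (ray \<theta>) g"
    and bnd: "\<And>r. 2 \<le> r \<Longrightarrow> norm (g (of_real r * cis \<theta>)) \<le> C / r^2"
    and "2 \<le> s" "s \<le> t"
  shows "norm (contour_integral (linepath (of_real s * cis \<theta>) (of_real t * cis \<theta>)) g) \<le> C / s - C / t"
proof -
  let ?p = "linepath (of_real s * cis \<theta>) (of_real t * cis \<theta>)"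
  have pos: "2 \<le> s + (t - s) * u" if "u \<in> {0..1}" for u
  proof -
    have "0 \<le> (t - s) * u" using assms that by simp
    then show ?thesis using assms by simp
  qed
  have "g contour_integrable_on ?p"
    using assms by (intro contour_integrable_continuous_linepath continuous_on_subset[OF cont] closed_segment_ray) auto
  then have int: "((\<lambda>u. g (?p u) * (of_real t * cis \<theta> - of_real s * cis \<theta>)) has_integral contour_integral ?p g) {0..1}"
    by (simp add: has_contour_integral_integral flip: has_contour_integral_linepath)
  define b where "b = (\<lambda>u. C / (s + (t - s) * u)^2 * (t - s))"
  have "(b has_integral (- C / (s + (t - s) * 1) - (- C / (s + (t - s) * 0)))) {0..1}"
  proof (rule fundamental_theorem_of_calculus)
    fix u :: real assume "u \<in> {0..1}"
    then have "s + (t - s) * u \<noteq> 0" using pos[of u] by simp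
    then show "((\<lambda>u. - C / (s + (t - s) * u)) has_vector_derivative b u) (at u within {0..1})"
      unfolding has_real_derivative_iff_has_vector_derivative[symmetric] b_def
      by (auto intro!: derivative_eq_intros simp: power2_eq_square algebra_simps diff_divide_distrib)
  qed simp
  then have intb: "(b has_integral (C / s - C / t)) {0..1}" by simp
  have "norm (integral {0..1} (\<lambda>u. g (?p u) * (of_real t * cis \<theta> - of_real s * cis \<theta>))) \<le> integral {0..1} b"
  proof (rule integral_norm_bound_integral)
    fix u :: real assume u: "u \<in> {0..1}"
    have "norm (of_real t * cis \<theta> - of_real s * cis \<theta>) = norm (of_real (t - s) * cis \<theta>)"
      by (simp add: algebra_simps)
    also have "\<dots> = t - s" using assms by (simp only: norm_mult norm_of_real norm_cis) simp
    finally have n: "norm (of_real t * cis \<theta> - of_real s * cis \<theta>) = t - s" .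
    show "norm (g (?p u) * (of_real t * cis \<theta> - of_real s * cis \<theta>)) \<le> b u"
      unfolding norm_mult n b_def linepath_ray using assms bnd[OF pos[OF u]] by (intro mult_right_mono) auto
  qed (use int intb in \<open>auto simp: has_integral_integrable\<close>)
  then show ?thesis unfolding integral_unique[OF int] integral_unique[OF intb] .
qed

text \<open>The truncated integrals satisfy a Cauchy condition. The limit is first taken along the
  integers, shifted by 2 because the decay bound starts at radius 2, and then extended to all real
  \<open>R\<close>.\<close>

lemma has_ray_integral_exists:
  assumes cont: "continuous_on (ray \<theta>) g"
    and bnd: "\<And>r. 2 \<le> r \<Longrightarrow> norm (g (of_real r * cis \<theta>)) \<le> C / r^2"
  shows "\<exists>I. has_ray_integral g \<theta> I"
proof -
  define J where "J = (\<lambda>R. ray_integral g \<theta> R)"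
  have C: "0 \<le> C" using norm_ge_zero[THEN order_trans, OF bnd[of 2]] by simp
  have diff: "norm (J t - J s) \<le> C / s" if "2 \<le> s" "s \<le> t" for s t
  proof -
    have "J t = J s + contour_integral (linepath (of_real s * cis \<theta>) (of_real t * cis \<theta>)) g"
      unfolding J_def
    proof (rule contour_integral_split_linepath)
      show "continuous_on (closed_segment (cis \<theta>) (of_real t * cis \<theta>)) g"
        using that by (intro continuous_on_subset[OF cont] closed_segment_ray') auto
      have "linepath (of_real 1 * cis \<theta>) (of_real t * cis \<theta>) ((s - 1) / (t - 1)) = of_real s * cis \<theta>"
        unfolding linepath_ray using that by simp
      moreover have "(s - 1) / (t - 1) \<in> {0..1}" using that by (simp add: divide_le_eq_1)
      ultimately show "of_real s * cis \<theta> \<in> closed_segment (cis \<theta>) (of_real t * cis \<theta>)"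
        using linepath_in_path[of "(s - 1) / (t - 1)" "of_real 1 * cis \<theta>" "of_real t * cis \<theta>"] by simp
    qed
    then have "norm (J t - J s) \<le> C / s - C / t"
      using ray_piece_bound[OF cont bnd that] by simp
    also have "\<dots> \<le> C / s" using C that by simp
    finally show ?thesis .
  qed
  have "Cauchy (\<lambda>n. J (real n + 2))"
  proof (rule metric_CauchyI)
    fix e :: real assume e: "0 < e"
    obtain N :: nat where N: "C / e < real N" using reals_Archimedean2 by blast
    have *: "dist (J (real m + 2)) (J (real n + 2)) < e" if "N \<le> n" "n \<le> m" for m n
    proof -
      have "norm (J (real m + 2) - J (real n + 2)) \<le> C / (real n + 2)"
        using that by (intro diff) auto
      also have "\<dots> < e"
      proof -
        have "C < real N * e" using N e by (simp add: divide_less_eq)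
        also have "\<dots> \<le> (real n + 2) * e" using that e by (intro mult_right_mono) auto
        finally show ?thesis by (simp add: divide_less_eq mult.commute)
      qed
      finally show ?thesis by (simp add: dist_norm)
    qed
    show "\<exists>M. \<forall>m\<ge>M. \<forall>n\<ge>M. dist (J (real m + 2)) (J (real n + 2)) < e"
      by (meson * dist_commute_lessI nle_le)
  qed
  then obtain L where L: "(\<lambda>n. J (real n + 2)) \<longlonglongrightarrow> L"
    using Cauchy_convergent convergent_def by blast
  \<comment> \<open>Letting the larger radius in \<open>diff\<close> tend to infinity along the
    integers gives a rate for every real \<open>s\<close>.\<close>
  have nb: "norm (L - J s) \<le> C / s" if "2 \<le> s" for s
  proof (rule tendsto_upperbound)
    show "(\<lambda>n. norm (J (real n + 2) - J s)) \<longlonglongrightarrow> norm (L - J s)"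
      by (intro tendsto_intros L)
    have "eventually (\<lambda>n. s \<le> real n) sequentially"
      using filterlim_real_sequentially by (simp add: filterlim_at_top)
    then show "eventually (\<lambda>n. norm (J (real n + 2) - J s) \<le> C / s) sequentially"
      by eventually_elim (use that in \<open>auto intro: diff\<close>)
  qed simp
  have "eventually (\<lambda>s. norm (J s - L) \<le> C / s) at_top"
    using eventually_ge_at_top[of 2] by eventually_elim (subst norm_minus_commute, erule nb)
  moreover have "((\<lambda>s. C / s) \<longlongrightarrow> 0) at_top"
    by (intro tendsto_divide_0[OF tendsto_const] filterlim_at_top_imp_at_infinity filterlim_ident)
  ultimately have "(J \<longlongrightarrow> L) at_top"
    by (rule Lim_null_comparison[THEN LIM_zero_cancel])
  moreover have "g contour_integrable_on linepath (cis \<theta>) (of_real R * cis \<theta>)" if "1 < R" for R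
    using that by (intro contour_integrable_continuous_linepath continuous_on_subset[OF cont] closed_segment_ray') auto
  ultimately show ?thesis unfolding has_ray_integral_def J_def by blast
qed

text \<open>The part c / z integrates exactly to c * i times the angle, whatever the radius. The
  rest is O(R^(-2)) on an arc of length O(R) and vanishes in the limit.\<close>

lemma arc_integral_tendsto:
  assumes "a < b"
    and cont: "\<And>r. 2 \<le> r \<Longrightarrow> continuous_on (path_image (part_circlepath 0 r a b)) g"
    and bnd: "\<And>r t. 2 \<le> r \<Longrightarrow> a \<le> t \<Longrightarrow> t \<le> b \<Longrightarrow>
        norm (g (of_real r * cis t) - c / (of_real r * cis t)) \<le> C / r^2"
  shows "((\<lambda>R. arc_integral g R a b) \<longlongrightarrow> c * \<i> * of_real (b - a)) at_top"
proof -
  have C: "0 \<le> C" using norm_ge_zero[THEN order_trans, OF bnd[of 2 a]] assms by simp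
  have *: "norm (arc_integral g R a b - c * \<i> * of_real (b - a)) \<le> C * (b - a) / R" if R: "2 \<le> R" for R
  proof -
    let ?p = "part_circlepath 0 R a b"
    have "(\<lambda>t. c / (0 + of_real R * cis t) * of_real R * \<i> * cis t) = (\<lambda>t. c * \<i>)"
      using R by (auto simp: fun_eq_iff)
    then have "((\<lambda>t. c / (0 + of_real R * cis t) * of_real R * \<i> * cis t) has_integral c * \<i> * of_real (b - a)) {a..b}"
      using has_integral_const_real[of "c * \<i>" a b] assms(1) by (simp add: scaleR_conv_of_real mult.commute)
    then have 1: "((\<lambda>z. c / z) has_contour_integral c * \<i> * of_real (b - a)) ?p"
      using assms(1) by (subst has_contour_integral_part_circlepath_iff) auto
    have 2: "(g has_contour_integral arc_integral g R a b) ?p"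
      using cont[OF R] by (intro has_contour_integral_integral contour_integrable_continuous_part_circlepath)
    note d = has_contour_integral_diff[OF 2 1]
    have "norm (arc_integral g R a b - c * \<i> * of_real (b - a)) \<le> C / R^2 * R * (b - a)"
      using d
    proof (rule has_contour_integral_bound_part_circlepath)
      fix z assume "z \<in> path_image ?p"
      then show "norm (g z - c / z) \<le> C / R^2"
        using assms(1) bnd[OF R] by (auto simp: path_image_part_circlepath' closed_segment_eq_real_ivl)
    qed (use C R assms in auto)
    also have "\<dots> = C * (b - a) / R" using R by (simp add: power2_eq_square field_simps)
    finally show ?thesis .
  qed
  have "eventually (\<lambda>R. norm (arc_integral g R a b - c * \<i> * of_real (b - a)) \<le> C * (b - a) / R) at_top"
    using eventually_ge_at_top[of 2] by eventually_elim (rule *)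
  moreover have "((\<lambda>R. C * (b - a) / R) \<longlongrightarrow> 0) at_top"
    by (intro tendsto_divide_0[OF tendsto_const] filterlim_at_top_imp_at_infinity filterlim_ident)
  ultimately show ?thesis
    by (subst LIM_zero_iff[symmetric]) (rule Lim_null_comparison)
qed

section \<open>Adjoining arcs, and Cauchy's theorem in a sector\<close>

lemma path_image_arc_subset:
  assumes "a \<le> b" "\<And>t. a \<le> t \<Longrightarrow> t \<le> b \<Longrightarrow> of_real r * cis t \<in> S"
  shows "path_image (part_circlepath 0 r a b) \<subseteq> S"
  using assms by (auto simp: path_image_part_circlepath' closed_segment_eq_real_ivl)

lemma arc_integral_split:
  assumes "continuous_on (path_image (part_circlepath 0 r a c)) g" "a < b" "b < c"
  shows "arc_integral g r a b + arc_integral g r b c = arc_integral g r a c"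
proof -
  have "g contour_integrable_on part_circlepath 0 r a c"
    using assms by (intro contour_integrable_continuous_part_circlepath)
  then have "(\<lambda>t. g (0 + of_real r * cis t) * of_real r * \<i> * cis t) integrable_on {a..c}"
    using assms by (subst (asm) contour_integrable_part_circlepath_iff) auto
  then show ?thesis
    using assms(2,3) by (simp add: contour_integral_part_circlepath_eq Henstock_Kurzweil_Integration.integral_combine)
qed

text \<open>A truncated sector with the unit disc removed is not convex, so a convex set
  \<open>S\<close> containing it is used: there \<open>g\<close> has a primitive, and each of the
  four boundary integrals is a difference of its values at two corners.\<close>

lemma sector_Cauchy:
  assumes "convex S" "open U" "g holomorphic_on U" "S \<subseteq> U" "a < b"
    and mem: "\<And>r t. 1 \<le> r \<Longrightarrow> a \<le> t \<Longrightarrow> t \<le> b \<Longrightarrow> of_real r * cis t \<in> S"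
    and R: "1 \<le> R"
  shows "ray_integral g b R - ray_integral g a R = arc_integral g R a b - arc_integral g 1 a b"
proof -
  have hol: "g field_differentiable at x" if "x \<in> S" for x
    using assms that by (meson holomorphic_on_imp_differentiable_at subsetD)
  have "continuous_on S g"
    using assms by (meson holomorphic_on_imp_continuous_on continuous_on_subset)
  then obtain G where G: "\<And>x. x \<in> S \<Longrightarrow> (G has_field_derivative g x) (at x within S)"
    using holomorphic_convex_primitive[of S "{}" g] assms(1) hol interior_subset by (metis Diff_empty finite.emptyI subsetD)
  have ray: "ray_integral g t R = G (of_real R * cis t) - G (cis t)" if "a \<le> t" "t \<le> b" for t
    using contour_integral_primitive[of S G g "linepath (cis t) (of_real R * cis t)", OF G]
      closed_segment_ray'[OF R, of t] that mem
    by (intro contour_integral_unique) (fastforce simp: ray_def)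
  have arc: "arc_integral g r a b = G (of_real r * cis b) - G (of_real r * cis a)" if "1 \<le> r" for r
    using contour_integral_primitive[of S G g "part_circlepath 0 r a b", OF G] path_image_arc_subset[of a b r S] that mem assms(5)
    by (intro contour_integral_unique) (auto simp: cis_conv_exp)
  show ?thesis using ray[of a] ray[of b] arc[of 1] arc[OF R] assms(5) by simp
qed

section \<open>The sector and its rotations in polar coordinates\<close>

lemma convex_sector: "convex sector"
proof -
  have half: "convex {z. Im (c * z) \<le> 0}" for c :: complex
  proof -
    have "{z. Im (c * z) \<le> 0} = {z. inner (Complex (Im c) (Re c)) z \<le> 0}"
      by (auto simp: inner_complex_def algebra_simps)
    then show ?thesis by (simp add: convex_halfspace_le)
  qed
  have *: "sector = {z. Im (alpha * z) \<le> 0} \<inter> {z. Im (alpha^2 * z) \<le> 0} \<inter> {z. 1/2 \<le> Im z}"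
    by (auto simp: sector_def)
  show ?thesis unfolding *
    by (rule convex_Int[OF convex_Int[OF half half] convex_halfspace_Im_ge])
qed

lemma convex_rotated_sector: "convex {z. c * z \<in> sector}"
proof -
  have "{z. c * z \<in> sector} = (*) c -` sector" by auto
  then show ?thesis by (simp add: convex_linear_vimage convex_sector bounded_linear.linear bounded_linear_mult_right)
qed

lemma in_sector:
  assumes "1 \<le> r" "pi / 3 \<le> t" "t \<le> 2 * pi / 3"
  shows "of_real r * cis t \<in> sector"
proof -
  have a: "Im (alpha * (of_real r * cis t)) = r * sin (2 * pi / 3 + t)"
       "Im (alpha^2 * (of_real r * cis t)) = r * sin (4 * pi / 3 + t)"
    unfolding alpha_cis(2) unfolding alpha_cis(1) mult.left_commute[of _ "of_real r"] cis_mult by simp_all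
  have "2 * pi / 3 + t = (t - pi / 3) + pi" "4 * pi / 3 + t = 2 * pi - (2 * pi / 3 - t)"
    by simp_all
  then have "sin (2 * pi / 3 + t) = - sin (t - pi / 3)" "sin (4 * pi / 3 + t) = - sin (2 * pi / 3 - t)"
    by (simp_all only: sin_periodic_pi sin_2pi_minus)
  moreover have "0 \<le> sin (t - pi / 3)" "0 \<le> sin (2 * pi / 3 - t)"
    using assms by (auto intro!: sin_ge_zero simp: field_simps)
  ultimately have "sin (2 * pi / 3 + t) \<le> 0" "sin (4 * pi / 3 + t) \<le> 0"
    by simp_all
  moreover have "1/2 \<le> sin t"
  proof -
    \<comment> \<open>The angle |pi/2 - t| is at most pi/6; comparison with pi/3 already gives the
      bound 1/2 in the definition of \<open>sector\<close>.\<close>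
    have "cos (pi / 3) \<le> cos \<bar>pi / 2 - t\<bar>"
      using assms by (intro cos_monotone_0_pi_le) (auto simp: abs_if field_simps)
    then show ?thesis by (simp add: cos_60 cos_diff)
  qed
  then have "1 * (1/2) \<le> r * sin t" using assms by (intro mult_mono) auto
  ultimately show ?thesis using assms(1) a by (auto simp: sector_def mult_nonneg_nonpos)
qed

lemma cis_add_2pi: "cis (x + 2 * pi) = cis x"
  by (simp add: complex_eq_iff)

text \<open>Multiplication by \<open>alpha\<close> adds 2 pi/3 to the argument, which carries this
  range to [pi/3, 2 pi/3] modulo 2 pi. The range ends at 2 pi, not 0, so that the arcs of the lower
  half-plane run from pi to 2 pi.\<close>

lemma in_rotated_sector1:
  assumes "1 \<le> r" "5 * pi / 3 \<le> t" "t \<le> 2 * pi"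
  shows "alpha * (of_real r * cis t) \<in> sector"
proof -
  have "alpha * (of_real r * cis t) = of_real r * cis (2 * pi / 3 + t)"
    unfolding alpha_cis(1) mult.left_commute[of _ "of_real r"] cis_mult ..
  also have "2 * pi / 3 + t = (t - 4 * pi / 3) + 2 * pi" by simp
  also have "cis \<dots> = cis (t - 4 * pi / 3)" by (rule cis_add_2pi)
  also have "of_real r * \<dots> \<in> sector" using assms by (intro in_sector) simp_all
  finally show ?thesis .
qed

lemma in_rotated_sector2:
  assumes "1 \<le> r" "pi \<le> t" "t \<le> 4 * pi / 3"
  shows "alpha^2 * (of_real r * cis t) \<in> sector"
proof -
  have "alpha^2 * (of_real r * cis t) = of_real r * cis (4 * pi / 3 + t)"
    unfolding alpha_cis(2) mult.left_commute[of _ "of_real r"] cis_mult ..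
  also have "4 * pi / 3 + t = (t - 2 * pi / 3) + 2 * pi" by simp
  also have "cis \<dots> = cis (t - 2 * pi / 3)" by (rule cis_add_2pi)
  also have "of_real r * \<dots> \<in> sector" using assms by (intro in_sector) simp_all
  finally show ?thesis .
qed

section \<open>Deformation of the contours\<close>

lemma has_contour_integral_arc_reverse:
  assumes "continuous_on (sphere 0 1) g"
  shows "(g has_contour_integral - arc_integral g 1 a b) (part_circlepath 0 1 b a)"
proof -
  have "g contour_integrable_on part_circlepath 0 1 b a"
    by (intro contour_integrable_continuous_part_circlepath continuous_on_subset[OF assms] path_image_part_circlepath_subset') auto
  then show ?thesis
    using has_contour_integral_integral contour_integral_part_circlepath_reverse by metis
qed

text \<open>The left-hand side is the integral from -R to R along the real axis indented below the
  origin by the unit semicircle. With a primitive only the endpoints matter, so it may be closed by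
  the large semicircle on either side.\<close>

lemma entire_close_contour:
  assumes "h holomorphic_on UNIV"
  shows "ray_integral h 0 R - ray_integral h pi R + arc_integral h 1 pi (2 * pi) = - arc_integral h R 0 pi"
    and "ray_integral h 0 R - ray_integral h pi R + arc_integral h 1 pi (2 * pi) = arc_integral h R pi (2 * pi)"
proof -
  obtain H where H: "\<And>x. (H has_field_derivative h x) (at x)"
    using holomorphic_convex_primitive'[OF convex_UNIV open_UNIV assms] by auto
  have *: "contour_integral p h = H (pathfinish p) - H (pathstart p)" if "valid_path p" for p
    using contour_integral_primitive[of UNIV H h p] H that by (intro contour_integral_unique) auto
  have "exp (2 * complex_of_real pi * \<i>) = 1" "exp (\<i> * complex_of_real pi) = -1"
    using exp_two_pi_i by (simp_all add: mult_ac)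
  then show "ray_integral h 0 R - ray_integral h pi R + arc_integral h 1 pi (2 * pi) = - arc_integral h R 0 pi"
     "ray_integral h 0 R - ray_integral h pi R + arc_integral h 1 pi (2 * pi) = arc_integral h R pi (2 * pi)"
    by (simp_all add: * mult_ac)
qed

text \<open>The linear algebra of the deformation. Index \<open>k\<close> stands for the angle k
  pi/3, index pairs for unit arcs between two such angles; \<open>rp\<close>, \<open>a\<close>
  belong to the integrand in the upper half-plane, \<open>rm\<close>, \<open>m\<close> to that in
  the lower, and \<open>u\<close>, \<open>v\<close> to the two parts of the jump. Capital letters
  other than \<open>I0\<close> are arcs of radius \<open>R\<close>.\<close>

lemma contour_bookkeeping:
  fixes I0 :: complex
  assumes "rp2 - rp1 = A0 - a12" "rm0 - rm5 = A1 - m56" "rm4 - rm3 = A2 - m34"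
    "rp0 = rm0 + (u0 + v0)" "rp3 = rm3 + (u3 + v3)" "a36 = m36 + (ua + va)"
    "I0 = a01 + a12 + a23 + a36" "m36 = m34 + m45 + m56" "u0 - u3 + ua = - U" "v0 - v3 + va = V"
  shows "I0 + ((- rp1 - a01 + rp0) + (- rp3 - a23 + rp2)) + (- rm5 - m45 + rm4) = A0 + A1 + A2 - U + V"
proof -
  have "rp2 = A0 - a12 + rp1" "rm0 = A1 - m56 + rm5" "rm4 = A2 - m34 + rm3" 
      "ua = - U - u0 + u3" "va = V - v0 + v3"
    using assms by (simp_all add: algebra_simps)
  with assms show ?thesis by simp
qed

text \<open>The deformation with the two problems abstracted away: only holomorphy, decay in the
  closed sectors and a jump that splits into two entire functions enter. Their leading terms at
  infinity, -c / z above and c / z below, contribute pi * i * c each.\<close>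

lemma contour_deformation:
  fixes gp gm h1 h2 :: "complex \<Rightarrow> complex"
  assumes U: "open U" and hol: "gp holomorphic_on U" "gm holomorphic_on U"
    and jump: "\<And>z. z \<in> U \<Longrightarrow> gp z = gm z + (h1 z + h2 z)"
    and disc: "ball 0 2 - {0} \<subseteq> U"
    and sec: "sector \<subseteq> U" "{z. alpha * z \<in> sector} \<subseteq> U" "{z. alpha^2 * z \<in> sector} \<subseteq> U"
    and bp: "\<And>z. z \<in> sector \<Longrightarrow> 2 \<le> norm z \<Longrightarrow> norm (gp z) \<le> C / norm z ^ 2"
    and bm1: "\<And>z. alpha * z \<in> sector \<Longrightarrow> 2 \<le> norm z \<Longrightarrow> norm (gm z) \<le> C / norm z ^ 2"
    and bm2: "\<And>z. alpha^2 * z \<in> sector \<Longrightarrow> 2 \<le> norm z \<Longrightarrow> norm (gm z) \<le> C / norm z ^ 2"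
    and holh: "h1 holomorphic_on UNIV" "h2 holomorphic_on UNIV"
    and bh1: "\<And>z. 0 \<le> Im z \<Longrightarrow> 2 \<le> norm z \<Longrightarrow> norm (h1 z + c / z) \<le> C / norm z ^ 2"
    and bh2: "\<And>z. Im z \<le> 0 \<Longrightarrow> 2 \<le> norm z \<Longrightarrow> norm (h2 z - c / z) \<le> C / norm z ^ 2"
  shows "\<exists>I0 Ip Iq. (gp has_contour_integral I0) (circlepath 0 (1/2)) \<and> has_Gamma_plus_integral gp Ip \<and>
           has_Gamma_minus_integral gm Iq \<and> 2 * of_real pi * \<i> * c = I0 + Ip + Iq"
proof -
  have cont: "continuous_on U gp" "continuous_on U gm"
    using hol by (auto intro: holomorphic_on_imp_continuous_on)
  have conth: "continuous_on S h1" "continuous_on S h2" for S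
    using holh by (auto intro: holomorphic_on_imp_continuous_on holomorphic_on_subset)
  have sph: "sphere 0 1 \<subseteq> U"
    using disc by auto
  have memU: "of_real r * cis t \<in> U" if "1 \<le> r" "pi / 3 \<le> t \<and> t \<le> 2 * pi / 3 \<or> 5 * pi / 3 \<le> t \<and> t \<le> 2 * pi \<or> pi \<le> t \<and> t \<le> 4 * pi / 3" for r t
    using that in_sector[of r t] in_rotated_sector1[of r t] in_rotated_sector2[of r t] sec by blast
  have rayU: "ray t \<subseteq> U" if "t = 0 \<or> pi / 3 \<le> t \<and> t \<le> 2 * pi / 3 \<or> 5 * pi / 3 \<le> t \<and> t \<le> 2 * pi \<or> pi \<le> t \<and> t \<le> 4 * pi / 3" for t
    using that memU[of _ t] memU[of _ "2 * pi"] by (auto simp: ray_def)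
  have rays: "ray 0 \<subseteq> U" "ray (pi/3) \<subseteq> U" "ray (2*pi/3) \<subseteq> U" "ray pi \<subseteq> U" "ray (4*pi/3) \<subseteq> U" "ray (5*pi/3) \<subseteq> U"
    by (rule rayU; simp)+
  note cont_ray = cont(1)[THEN continuous_on_subset] cont(2)[THEN continuous_on_subset]
  have C: "0 \<le> C"
    using norm_ge_zero[THEN order_trans, OF bh1[of 2]] by simp
  \<comment> \<open>On the real axis the decay of \<open>gp\<close> comes from that of
    \<open>gm\<close> through the jump: both half-plane estimates hold there and the terms with
    \<open>c\<close> cancel.\<close>
  have real_bound: "norm (gp z) \<le> 3 * C / norm z ^ 2"
    if "alpha * z \<in> sector \<or> alpha^2 * z \<in> sector" "Im z = 0" "2 \<le> norm z" for z
  proof -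
    have "gp z = gm z + ((h1 z + c / z) + (h2 z - c / z))"
      using that(1) sec by (subst jump) auto
    also have "norm \<dots> \<le> C / norm z ^ 2 + (C / norm z ^ 2 + C / norm z ^ 2)"
      using that by (intro norm_triangle_le add_mono bh1 bh2) (auto intro: bm1 bm2)
    finally show ?thesis by simp
  qed
  have rb: "norm (of_real r * cis t) = r" if "2 \<le> r" for r t
    using that by (simp add: norm_mult)
  obtain J0 where J0: "has_ray_integral gp 0 J0"
  proof -
    have "norm (gp (of_real r * cis 0)) \<le> 3 * C / r ^ 2" if "2 \<le> r" for r
      using in_rotated_sector1[of r "2 * pi"] real_bound[of "of_real r * cis 0"] rb[OF that, of 0] that by simp
    from has_ray_integral_exists[OF cont_ray(1)[OF rays(1)] this] show ?thesis using that by blast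
  qed
  obtain J1 where J1: "has_ray_integral gp (pi/3) J1"
  proof -
    have "norm (gp (of_real r * cis (pi/3))) \<le> C / r ^ 2" if "2 \<le> r" for r
      using bp[of "of_real r * cis (pi/3)", unfolded rb[OF that]] in_sector[of r "pi/3"] that by simp
    from has_ray_integral_exists[OF cont_ray(1)[OF rays(2)] this] show ?thesis using that by blast
  qed
  obtain J2 where J2: "has_ray_integral gp (2*pi/3) J2"
  proof -
    have "norm (gp (of_real r * cis (2*pi/3))) \<le> C / r ^ 2" if "2 \<le> r" for r
      using bp[of "of_real r * cis (2*pi/3)", unfolded rb[OF that]] in_sector[of r "2*pi/3"] that by simp
    from has_ray_integral_exists[OF cont_ray(1)[OF rays(3)] this] show ?thesis using that by blast
  qed
  obtain J3 where J3: "has_ray_integral gp pi J3"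
  proof -
    have "norm (gp (of_real r * cis pi)) \<le> 3 * C / r ^ 2" if "2 \<le> r" for r
      using in_rotated_sector2[of r pi] real_bound[of "of_real r * cis pi"] rb[OF that, of pi] that by simp
    from has_ray_integral_exists[OF cont_ray(1)[OF rays(4)] this] show ?thesis using that by blast
  qed
  obtain J4 where J4: "has_ray_integral gm (4*pi/3) J4"
  proof -
    have "norm (gm (of_real r * cis (4*pi/3))) \<le> C / r ^ 2" if "2 \<le> r" for r
      using bm2[of "of_real r * cis (4*pi/3)", unfolded rb[OF that]] in_rotated_sector2[of r "4*pi/3"] that by simp
    from has_ray_integral_exists[OF cont_ray(2)[OF rays(5)] this] show ?thesis using that by blast
  qed
  obtain J5 where J5: "has_ray_integral gm (5*pi/3) J5"
  proof -
    have "norm (gm (of_real r * cis (5*pi/3))) \<le> C / r ^ 2" if "2 \<le> r" for r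
      using bm1[of "of_real r * cis (5*pi/3)", unfolded rb[OF that]] in_rotated_sector1[of r "5*pi/3"] that by simp
    from has_ray_integral_exists[OF cont_ray(2)[OF rays(6)] this] show ?thesis using that by blast
  qed

  \<comment> \<open>The unit circle may replace \<open>Gamma0\<close>: \<open>gp\<close> is
    holomorphic in the punctured disc of radius 2, so both circles give 2 pi i times the residue at
    0.\<close>
  define I0 where "I0 = contour_integral (circlepath 0 1) gp"
  have circ: "(gp has_contour_integral I0) (circlepath 0 (1/2))"
  proof -
    have "(gp has_contour_integral 2 * pi * \<i> * residue gp 0) (circlepath 0 r)" if "0 < r" "r < 2" for r
      using that disc
      by (intro base_residue[of "ball 0 2"] holomorphic_on_subset[OF hol(1)]) auto
    from this[of 1] this[of "1/2"] show ?thesis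
      by (simp add: I0_def contour_integral_unique)
  qed
  define Ip where "Ip = (- J1 - arc_integral gp 1 0 (pi/3) + J0) + (- J3 - arc_integral gp 1 (2*pi/3) pi + J2)"
  define Iq where "Iq = - J5 - arc_integral gm 1 (4*pi/3) (5*pi/3) + J4"
  have arcs: "(g has_contour_integral - arc_integral g 1 a b) (part_circlepath 0 1 b a)" if "continuous_on U g" for g a b
    by (intro has_contour_integral_arc_reverse continuous_on_subset[OF that] sph)
  have Ip: "has_Gamma_plus_integral gp Ip"
    unfolding has_Gamma_plus_integral_def has_sector_boundary_integral_def Ip_def
    using J0 J1 J2 J3 arcs[OF cont(1)] by (metis diff_conv_add_uminus)
  have Iq: "has_Gamma_minus_integral gm Iq"
    unfolding has_Gamma_minus_integral_def has_sector_boundary_integral_def Iq_def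
    using J4 J5 arcs[OF cont(2)] by (metis diff_conv_add_uminus)

  define T where "T = (\<lambda>R. I0 + ((- ray_integral gp (pi/3) R - arc_integral gp 1 0 (pi/3) + ray_integral gp 0 R)
      + (- ray_integral gp pi R - arc_integral gp 1 (2*pi/3) pi + ray_integral gp (2*pi/3) R))
      + (- ray_integral gm (5*pi/3) R - arc_integral gm 1 (4*pi/3) (5*pi/3) + ray_integral gm (4*pi/3) R))"
  have lim1: "(T \<longlongrightarrow> I0 + Ip + Iq) at_top"
    using J0 J1 J2 J3 J4 J5 unfolding T_def Ip_def Iq_def has_ray_integral_def by (intro tendsto_intros) auto

  \<comment> \<open>These are the arcs that close the truncated contours. Those of \<open>gp\<close>
    and \<open>gm\<close> vanish in the limit; those of \<open>h1\<close> and \<open>h2\<close>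
    survive.\<close>
  define A where "A = (\<lambda>R. arc_integral gp R (pi/3) (2*pi/3) + arc_integral gm R (5*pi/3) (2*pi)
      + arc_integral gm R pi (4*pi/3) - arc_integral h1 R 0 pi + arc_integral h2 R pi (2*pi))"
  have "(A \<longlongrightarrow> 0 * \<i> * of_real (2*pi/3 - pi/3) + 0 * \<i> * of_real (2*pi - 5*pi/3) + 0 * \<i> * of_real (4*pi/3 - pi)
      - (- c) * \<i> * of_real (pi - 0) + c * \<i> * of_real (2 * pi - pi)) at_top"
    unfolding A_def
  proof (intro tendsto_add tendsto_diff)
    show "((\<lambda>R. arc_integral gp R (pi/3) (2*pi/3)) \<longlongrightarrow> 0 * \<i> * of_real (2*pi/3 - pi/3)) at_top"
    proof (rule arc_integral_tendsto)
      show "continuous_on (path_image (part_circlepath 0 r (pi/3) (2*pi/3))) gp" if "2 \<le> r" for r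
        using that by (intro continuous_on_subset[OF cont(1)] path_image_arc_subset memU) auto
      show "norm (gp (of_real r * cis t) - 0 / (of_real r * cis t)) \<le> C / r^2" if "2 \<le> r" "pi/3 \<le> t" "t \<le> 2*pi/3" for r t
        using bp[of "of_real r * cis t", unfolded rb[OF that(1)]] in_sector[of r t] that by simp
    qed simp
    show "((\<lambda>R. arc_integral gm R (5*pi/3) (2*pi)) \<longlongrightarrow> 0 * \<i> * of_real (2*pi - 5*pi/3)) at_top"
    proof (rule arc_integral_tendsto)
      show "continuous_on (path_image (part_circlepath 0 r (5*pi/3) (2*pi))) gm" if "2 \<le> r" for r
        using that by (intro continuous_on_subset[OF cont(2)] path_image_arc_subset memU) auto
      show "norm (gm (of_real r * cis t) - 0 / (of_real r * cis t)) \<le> C / r^2" if "2 \<le> r" "5*pi/3 \<le> t" "t \<le> 2*pi" for r t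
        using bm1[of "of_real r * cis t", unfolded rb[OF that(1)]] in_rotated_sector1[of r t] that by simp
    qed simp
    show "((\<lambda>R. arc_integral gm R pi (4*pi/3)) \<longlongrightarrow> 0 * \<i> * of_real (4*pi/3 - pi)) at_top"
    proof (rule arc_integral_tendsto)
      show "continuous_on (path_image (part_circlepath 0 r pi (4*pi/3))) gm" if "2 \<le> r" for r
        using that by (intro continuous_on_subset[OF cont(2)] path_image_arc_subset memU) auto
      show "norm (gm (of_real r * cis t) - 0 / (of_real r * cis t)) \<le> C / r^2" if "2 \<le> r" "pi \<le> t" "t \<le> 4*pi/3" for r t
        using bm2[of "of_real r * cis t", unfolded rb[OF that(1)]] in_rotated_sector2[of r t] that by simp
    qed simp
    show "((\<lambda>R. arc_integral h1 R 0 pi) \<longlongrightarrow> (- c) * \<i> * of_real (pi - 0)) at_top"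
    proof (rule arc_integral_tendsto)
      show "norm (h1 (of_real r * cis t) - (- c) / (of_real r * cis t)) \<le> C / r^2" if "2 \<le> r" "0 \<le> t" "t \<le> pi" for r t
        using bh1[of "of_real r * cis t", unfolded rb[OF that(1)]] that by (simp add: sin_ge_zero)
    qed (use conth in auto)
    show "((\<lambda>R. arc_integral h2 R pi (2*pi)) \<longlongrightarrow> c * \<i> * of_real (2 * pi - pi)) at_top"
    proof (rule arc_integral_tendsto)
      show "norm (h2 (of_real r * cis t) - c / (of_real r * cis t)) \<le> C / r^2" if "2 \<le> r" "pi \<le> t" "t \<le> 2 * pi" for r t
      proof -
        have "sin t \<le> 0" using sin_ge_zero[of "2 * pi - t"] that by simp
        then show ?thesis
          using bh2[of "of_real r * cis t", unfolded rb[OF that(1)]] that by (simp add: mult_nonneg_nonpos)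
      qed
    qed (use conth in auto)
  qed
  then have lim2: "(A \<longlongrightarrow> 2 * of_real pi * \<i> * c) at_top"
    by (simp add: algebra_simps)

  \<comment> \<open>At each finite radius the identity is exact, by Cauchy's theorem in the three
    sectors and for the entire parts; limits are taken only afterwards.\<close>
  have TA: "T R = A R" if R: "1 \<le> R" for R
  proof -
    have s0: "ray_integral gp (2*pi/3) R - ray_integral gp (pi/3) R = arc_integral gp R (pi/3) (2*pi/3) - arc_integral gp 1 (pi/3) (2*pi/3)"
      by (rule sector_Cauchy[OF convex_sector U hol(1) sec(1)]) (use in_sector R in auto)
    have s1: "ray_integral gm (2*pi) R - ray_integral gm (5*pi/3) R = arc_integral gm R (5*pi/3) (2*pi) - arc_integral gm 1 (5*pi/3) (2*pi)"
      by (rule sector_Cauchy[OF convex_rotated_sector U hol(2) sec(2)]) (use in_rotated_sector1 R in auto)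
    have s2: "ray_integral gm (4*pi/3) R - ray_integral gm pi R = arc_integral gm R pi (4*pi/3) - arc_integral gm 1 pi (4*pi/3)"
      by (rule sector_Cauchy[OF convex_rotated_sector U hol(2) sec(3)]) (use in_rotated_sector2 R in auto)
    have split: "arc_integral g 1 a b + arc_integral g 1 b d = arc_integral g 1 a d" if "continuous_on U g" "a < b" "b < d" for g a b d
      using that by (intro arc_integral_split continuous_on_subset[OF that(1)] subset_trans[OF path_image_part_circlepath_subset' sph]) auto
    have add: "contour_integral p gp = contour_integral p gm + (contour_integral p h1 + contour_integral p h2)"
      if "path_image p \<subseteq> U" "\<And>g. continuous_on (path_image p) g \<Longrightarrow> g contour_integrable_on p" for p
    proof -
      have i: "gm contour_integrable_on p" "h1 contour_integrable_on p" "h2 contour_integrable_on p"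
        using that cont conth by (auto intro: continuous_on_subset)
      have "contour_integral p gp = contour_integral p (\<lambda>z. gm z + (h1 z + h2 z))"
        using that(1) by (intro contour_integral_eq jump) auto
      also have "\<dots> = contour_integral p gm + (contour_integral p h1 + contour_integral p h2)"
        using i by (simp add: contour_integral_add contour_integrable_add)
      finally show ?thesis .
    qed
    have add_ray: "ray_integral gp t R = ray_integral gm t R + (ray_integral h1 t R + ray_integral h2 t R)" if "ray t \<subseteq> U" for t
      using that closed_segment_ray'[OF R, of t] by (intro add contour_integrable_continuous_linepath) auto
    have add_arc: "arc_integral gp 1 pi (2*pi) = arc_integral gm 1 pi (2*pi) + (arc_integral h1 1 pi (2*pi) + arc_integral h2 1 pi (2*pi))"
      by (intro add contour_integrable_continuous_part_circlepath subset_trans[OF path_image_part_circlepath_subset' sph]) auto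
    have c1: "I0 = arc_integral gp 1 0 (pi/3) + arc_integral gp 1 (pi/3) (2*pi/3) + arc_integral gp 1 (2*pi/3) pi + arc_integral gp 1 pi (2*pi)"
      using split[OF cont(1), of 0 "pi/3" "2*pi/3"] split[OF cont(1), of 0 "2*pi/3" pi] split[OF cont(1), of 0 pi "2*pi"]
      by (simp add: I0_def circlepath_def)
    have c2: "arc_integral gm 1 pi (2*pi) = arc_integral gm 1 pi (4*pi/3) + arc_integral gm 1 (4*pi/3) (5*pi/3) + arc_integral gm 1 (5*pi/3) (2*pi)"
      using split[OF cont(2), of pi "4*pi/3" "5*pi/3"] split[OF cont(2), of pi "5*pi/3" "2*pi"] by simp
    show ?thesis
      \<comment> \<open>The premise left open is \<open>s1\<close>, where the positive real axis
        appears at angle 2 pi; simplification identifies it with angle 0.\<close>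
      unfolding T_def A_def
      by (rule contour_bookkeeping[OF s0 _ s2 add_ray[OF rays(1)] add_ray[OF rays(4)] add_arc c1 c2
            entire_close_contour(1)[OF holh(1)] entire_close_contour(2)[OF holh(2)]]) (use s1 in simp)
  qed
  have "eventually (\<lambda>R. T R = A R) at_top"
    using eventually_ge_at_top[of 1] by eventually_elim (rule TA)
  with lim1 have "(A \<longlongrightarrow> I0 + Ip + Iq) at_top"
    by (simp add: tendsto_cong)
  then have "2 * of_real pi * \<i> * c = I0 + Ip + Iq"
    using lim2 tendsto_unique trivial_limit_at_top_linorder by blast
  then show ?thesis using circ Ip Iq by blast
qed

section \<open>The Fourier transform on an interval\<close>

lemma smooth01_derivs:
  assumes "smooth01 f"
  shows "\<And>t. t \<in> {0..1} \<Longrightarrow> (f has_vector_derivative deriv01 f t) (at t within {0..1})"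
    and "\<And>t. t \<in> {0..1} \<Longrightarrow> (deriv01 f has_vector_derivative deriv01 (deriv01 f) t) (at t within {0..1})"
    and "continuous_on {0..1} f" "continuous_on {0..1} (deriv01 f)" "continuous_on {0..1} (deriv01 (deriv01 f))"
proof -
  have d: "f differentiable_on {0..1}" "deriv01 f differentiable_on {0..1}" "deriv01 (deriv01 f) differentiable_on {0..1}"
    using assms[unfolded smooth01_def, rule_format, of 0] assms[unfolded smooth01_def, rule_format, of 1]
      assms[unfolded smooth01_def, rule_format, of 2] by (simp_all add: numeral_2_eq_2)
  have D: "(g has_vector_derivative deriv01 g t) (at t within {0..1})" if "g differentiable_on {0..1}" "t \<in> {0..1}" for g t
    using that by (simp add: deriv01_def differentiable_on_def flip: vector_derivative_works)
  show "\<And>t. t \<in> {0..1} \<Longrightarrow> (f has_vector_derivative deriv01 f t) (at t within {0..1})"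
       "\<And>t. t \<in> {0..1} \<Longrightarrow> (deriv01 f has_vector_derivative deriv01 (deriv01 f) t) (at t within {0..1})"
    using D d by blast+
  show "continuous_on {0..1} f" "continuous_on {0..1} (deriv01 f)" "continuous_on {0..1} (deriv01 (deriv01 f))"
    using d by (auto intro: differentiable_imp_continuous_on)
qed

text \<open>The interval is a parameter because the inversion splits the transform at
  \<open>x\<close>.\<close>

definition fourier :: "(real \<Rightarrow> complex) \<Rightarrow> real \<Rightarrow> real \<Rightarrow> complex \<Rightarrow> complex" where
  "fourier f a b z = integral {a..b} (\<lambda>t. exp (- \<i> * z * of_real t) * f t)"

lemma norm_exp_fourier: "norm (exp (- \<i> * z * of_real t)) = exp (t * Im z)"
  by (simp add: mult.commute)

text \<open>Two integrations by parts: the boundary values of \<open>f\<close> give the leading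
  term, while those of \<open>f'\<close> and the integral of \<open>f''\<close> form the error.
  \<open>E\<close> controls the exponential on the interval.\<close>

lemma fourier_expansion:
  fixes f f' f'' :: "real \<Rightarrow> complex"
  assumes "a \<le> b" "z \<noteq> 0"
    and f: "\<And>t. t \<in> {a..b} \<Longrightarrow> (f has_vector_derivative f' t) (at t within {a..b})"
    and f': "\<And>t. t \<in> {a..b} \<Longrightarrow> (f' has_vector_derivative f'' t) (at t within {a..b})"
    and cont: "continuous_on {a..b} f''"
    and M: "\<And>t. t \<in> {a..b} \<Longrightarrow> norm (f' t) \<le> M" "\<And>t. t \<in> {a..b} \<Longrightarrow> norm (f'' t) \<le> M"
    and E: "\<And>t. t \<in> {a..b} \<Longrightarrow> exp (t * Im z) \<le> E"
  shows "norm (fourier f a b z - (exp (- \<i> * z * of_real a) * f a - exp (- \<i> * z * of_real b) * f b) / (\<i> * z))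
          \<le> (2 + (b - a)) * M * E / norm z ^ 2"
proof -
  define e where "e = (\<lambda>t::real. exp (- \<i> * z * of_real t))"
  have e': "(e has_vector_derivative - \<i> * z * e t) (at t within S)" for t S
  proof -
    have "((\<lambda>w. exp (- \<i> * z * w)) has_field_derivative - \<i> * z * e t) (at (of_real t))"
      unfolding e_def by (auto intro!: derivative_eq_intros)
    then show ?thesis unfolding e_def by (rule has_vector_derivative_real_field)
  qed
  have conte: "continuous_on S e" for S unfolding e_def by (intro continuous_intros)
  have contf: "continuous_on {a..b} f"
    using f by (meson continuous_on_eq_continuous_within has_vector_derivative_continuous)
  \<comment> \<open>Up to a term with f'' / z^2 this is a primitive of the integrand, which performs
    both integrations by parts at once.\<close>
  define G where "G = (\<lambda>t. e t * (f t * (\<i> / z) + f' t / z^2))"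
  have "((\<lambda>t. e t * f t + e t * f'' t / z^2) has_integral G b - G a) {a..b}"
  proof (rule fundamental_theorem_of_calculus)
    fix t assume t: "t \<in> {a..b}"
    have d: "((\<lambda>t. f t * (\<i> / z) + f' t / z^2) has_vector_derivative f' t * (\<i> / z) + f'' t / z^2) (at t within {a..b})"
      using f[OF t] f'[OF t]
      by (auto intro!: has_vector_derivative_add has_vector_derivative_mult_left has_vector_derivative_divide)
    have "(G has_vector_derivative e t * (f' t * (\<i> / z) + f'' t / z^2) + (- \<i> * z * e t) * (f t * (\<i> / z) + f' t / z^2)) (at t within {a..b})"
      unfolding G_def by (rule has_vector_derivative_mult[OF e' d])
    also have "e t * (f' t * (\<i> / z) + f'' t / z^2) + (- \<i> * z * e t) * (f t * (\<i> / z) + f' t / z^2) = e t * f t + e t * f'' t / z^2"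
      using assms(2) by (simp add: field_simps power2_eq_square)
    finally show "(G has_vector_derivative e t * f t + e t * f'' t / z^2) (at t within {a..b})" .
  qed (use assms in simp)
  then have "integral {a..b} (\<lambda>t. e t * f t + e t * f'' t / z^2) = G b - G a"
    by (rule integral_unique)
  moreover have i: "(\<lambda>t. e t * f t) integrable_on {a..b}" "(\<lambda>t. e t * f'' t) integrable_on {a..b}"
    by (intro integrable_continuous_real continuous_intros conte contf cont)+
  moreover have "integral {a..b} (\<lambda>t. e t * f t + e t * f'' t / z^2) = fourier f a b z + integral {a..b} (\<lambda>t. e t * f'' t) / z^2"
    using i by (simp add: Henstock_Kurzweil_Integration.integral_add fourier_def e_def integrable_on_divide)
  ultimately have "fourier f a b z = G b - G a - integral {a..b} (\<lambda>t. e t * f'' t) / z^2"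
    by (simp add: algebra_simps)
  then have "fourier f a b z - (e a * f a - e b * f b) / (\<i> * z)
      = e b * f' b / z^2 + - (e a * f' a / z^2) + - (integral {a..b} (\<lambda>t. e t * f'' t) / z^2)"
    by (simp add: G_def divide_inverse algebra_simps)
  also have "norm \<dots> \<le> E * M / norm z ^ 2 + E * M / norm z ^ 2 + E * M * (b - a) / norm z ^ 2"
  proof -
    have eE: "norm (e t) \<le> E" if "t \<in> {a..b}" for t
      using E[OF that] unfolding e_def norm_exp_fourier .
    have "0 \<le> E" using order_trans[OF norm_ge_zero eE[of a]] assms(1) by simp
    moreover have "0 \<le> M" using order_trans[OF norm_ge_zero M(1)[of a]] assms(1) by simp
    moreover have "norm (integral {a..b} (\<lambda>t. e t * f'' t)) \<le> E * M * (b - a)"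
      using assms(1) eE M \<open>0 \<le> E\<close>
      by (intro integral_bound) (auto intro!: continuous_intros conte cont simp: norm_mult mult_mono)
    ultimately show ?thesis
      using eE M assms(1)
      by (intro norm_triangle_le add_mono) (auto simp: norm_mult norm_divide norm_power intro!: divide_right_mono mult_mono)
  qed
  also have "\<dots> = (2 + (b - a)) * M * E / norm z ^ 2"
    by (simp add: algebra_simps add_divide_distrib diff_divide_distrib)
  finally show ?thesis by (simp add: e_def)
qed

text \<open>One constant serves all subintervals: the bound \<open>M\<close> on the derivatives is
  taken over [0,1], and 2 + (b - a) is at most 3.\<close>

lemma fourier_bound:
  assumes "smooth01 f"
  obtains K where "0 \<le> K"
    "\<And>a b z E. \<lbrakk>0 \<le> a; a \<le> b; b \<le> 1; z \<noteq> 0; \<And>t. t \<in> {a..b} \<Longrightarrow> exp (t * Im z) \<le> E\<rbrakk> \<Longrightarrow>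
      norm (fourier f a b z - (exp (- \<i> * z * of_real a) * f a - exp (- \<i> * z * of_real b) * f b) / (\<i> * z))
          \<le> K * E / norm z ^ 2"
proof -
  note d = smooth01_derivs[OF assms]
  have "bounded (deriv01 f ` {0..1} \<union> deriv01 (deriv01 f) ` {0..1})"
    using d(4,5) by (simp add: compact_continuous_image compact_imp_bounded)
  then obtain M where "0 < M" "\<forall>w \<in> deriv01 f ` {0..1} \<union> deriv01 (deriv01 f) ` {0..1}. norm w \<le> M"
    unfolding bounded_pos by blast
  then have M: "0 \<le> M" "\<And>t. t \<in> {0..1} \<Longrightarrow> norm (deriv01 f t) \<le> M" "\<And>t. t \<in> {0..1} \<Longrightarrow> norm (deriv01 (deriv01 f) t) \<le> M"
    by auto
  show ?thesis
  proof (rule that[of "3 * M"])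
    fix a b E :: real and z :: complex
    assume ab: "0 \<le> a" "a \<le> b" "b \<le> 1" and z: "z \<noteq> 0" and E: "\<And>t. t \<in> {a..b} \<Longrightarrow> exp (t * Im z) \<le> E"
    have sub: "{a..b} \<subseteq> {0..1}" using ab by auto
    have "0 \<le> E" using order_trans[OF exp_ge_zero E[of a]] ab by simp
    have "norm (fourier f a b z - (exp (- \<i> * z * of_real a) * f a - exp (- \<i> * z * of_real b) * f b) / (\<i> * z))
        \<le> (2 + (b - a)) * M * E / norm z ^ 2"
    proof (rule fourier_expansion[where f' = "deriv01 f" and f'' = "deriv01 (deriv01 f)"])
      show "(f has_vector_derivative deriv01 f t) (at t within {a..b})" if "t \<in> {a..b}" for t
        using that sub by (intro has_vector_derivative_within_subset[OF d(1) sub]) auto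
      show "(deriv01 f has_vector_derivative deriv01 (deriv01 f) t) (at t within {a..b})" if "t \<in> {a..b}" for t
        using that sub by (intro has_vector_derivative_within_subset[OF d(2) sub]) auto
    qed (use sub M E ab z continuous_on_subset[OF d(5) sub] in auto)
    also have "\<dots> \<le> 3 * M * E / norm z ^ 2"
      using ab M(1) \<open>0 \<le> E\<close> by (intro divide_right_mono mult_right_mono) auto
    finally show "norm (fourier f a b z - (exp (- \<i> * z * of_real a) * f a - exp (- \<i> * z * of_real b) * f b) / (\<i> * z))
        \<le> 3 * M * E / norm z ^ 2" .
  qed (use M in simp)
qed

lemma holomorphic_fourier:
  assumes "continuous_on {a..b} f"
  shows "fourier f a b holomorphic_on S"
proof -
  have "(\<lambda>z. integral (cbox a b) (\<lambda>t. exp (- \<i> * z * of_real t) * f t)) holomorphic_on UNIV"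
  proof (rule leibniz_rule_holomorphic)
    show "((\<lambda>z. exp (- \<i> * z * of_real t) * f t) has_field_derivative - \<i> * of_real t * exp (- \<i> * z * of_real t) * f t) (at z within UNIV)" for z t
      by (auto intro!: derivative_eq_intros)
    show "(\<lambda>t. exp (- \<i> * z * of_real t) * f t) integrable_on cbox a b" for z
      unfolding cbox_interval using assms by (intro integrable_continuous_real continuous_intros)
    have "continuous_on (UNIV \<times> cbox a b) (\<lambda>w::complex \<times> real. f (snd w))"
      using assms by (intro continuous_on_compose2[OF assms]) (auto intro!: continuous_intros)
    then show "continuous_on (UNIV \<times> cbox a b) (\<lambda>(z, t). - \<i> * of_real t * exp (- \<i> * z * of_real t) * f t)"
      unfolding case_prod_beta by (intro continuous_intros)
  qed simp
  then show ?thesis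
    unfolding fourier_def[abs_def] by (auto intro: holomorphic_on_subset)
qed

lemma fourier_combine:
  assumes "continuous_on {0..1} f" "0 \<le> x" "x \<le> 1"
  shows "fourier f 0 1 z = fourier f 0 x z + fourier f x 1 z"
  unfolding fourier_def using assms
  by (intro Henstock_Kurzweil_Integration.integral_combine[symmetric] integrable_continuous_real continuous_intros)

text \<open>The leading boundary terms vanish with \<open>f\<close>. As t runs through [0,1], the
  exponent t * Im z is at most 0 in the lower half-plane and at most Im z in the upper.\<close>

lemma fourier_decay:
  assumes "smooth01 f" "f 0 = 0" "f 1 = 0"
  obtains K where "0 \<le> K" "\<And>z. z \<noteq> 0 \<Longrightarrow> Im z \<le> 0 \<Longrightarrow> norm (fourier f 0 1 z) \<le> K / norm z ^ 2"
    "\<And>z. z \<noteq> 0 \<Longrightarrow> 0 \<le> Im z \<Longrightarrow> norm (fourier f 0 1 z) \<le> exp (Im z) * (K / norm z ^ 2)"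
proof -
  obtain K where K: "0 \<le> K" "\<And>a b z E. \<lbrakk>0 \<le> a; a \<le> b; b \<le> 1; z \<noteq> 0; \<And>t. t \<in> {a..b} \<Longrightarrow> exp (t * Im z) \<le> E\<rbrakk> \<Longrightarrow>
      norm (fourier f a b z - (exp (- \<i> * z * of_real a) * f a - exp (- \<i> * z * of_real b) * f b) / (\<i> * z))
          \<le> K * E / norm z ^ 2"
    by (rule fourier_bound[OF assms(1)]) blast
  show ?thesis
  proof (rule that[OF K(1)])
    show "norm (fourier f 0 1 z) \<le> K / norm z ^ 2" if "z \<noteq> 0" "Im z \<le> 0" for z
      using K(2)[of 0 1 z 1] that assms by (simp add: mult_nonneg_nonpos)
    show "norm (fourier f 0 1 z) \<le> exp (Im z) * (K / norm z ^ 2)" if "z \<noteq> 0" "0 \<le> Im z" for z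
      using K(2)[of 0 1 z "exp (Im z)"] that assms by (simp add: mult_left_le_one_le mult.commute)
  qed
qed

section \<open>Points on the contours\<close>

text \<open>\<open>functional\<close> is specified on the contours only, so integrals of the
  analytic formulas are transferred to it by agreement on the paths.\<close>

lemma has_ray_integral_cong:
  assumes "has_ray_integral g \<theta> I" "\<And>r. 1 \<le> r \<Longrightarrow> g (of_real r * cis \<theta>) = g' (of_real r * cis \<theta>)"
  shows "has_ray_integral g' \<theta> I"
proof -
  have eq: "g z = g' z" if "z \<in> path_image (linepath (cis \<theta>) (of_real R * cis \<theta>))" "1 < R" for R z
    using closed_segment_ray'[of R \<theta>] that assms(2) by (force simp: ray_def)
  then have "\<forall>R>1. g' contour_integrable_on linepath (cis \<theta>) (of_real R * cis \<theta>)"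
    using assms(1) unfolding has_ray_integral_def by (meson contour_integrable_eq)
  moreover have "eventually (\<lambda>R. ray_integral g \<theta> R = ray_integral g' \<theta> R) at_top"
    using eventually_gt_at_top[of 1] by eventually_elim (intro contour_integral_eq eq)
  ultimately show ?thesis
    using assms(1) unfolding has_ray_integral_def by (auto simp: tendsto_cong)
qed

lemma has_sector_boundary_integral_cong:
  assumes "has_sector_boundary_integral g a b I" "a \<le> b"
    and "\<And>r. 1 \<le> r \<Longrightarrow> g (of_real r * cis a) = g' (of_real r * cis a)"
    and "\<And>r. 1 \<le> r \<Longrightarrow> g (of_real r * cis b) = g' (of_real r * cis b)"
    and "\<And>t. a \<le> t \<Longrightarrow> t \<le> b \<Longrightarrow> g (cis t) = g' (cis t)"
  shows "has_sector_boundary_integral g' a b I"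
proof -
  have "(g' has_contour_integral J) (part_circlepath 0 1 b a)" if "(g has_contour_integral J) (part_circlepath 0 1 b a)" for J
    using that assms(2,5)
    by (elim has_contour_integral_eq) (auto simp: path_image_part_circlepath' closed_segment_eq_real_ivl split: if_splits)
  then show ?thesis
    using assms(1) has_ray_integral_cong assms(3,4) unfolding has_sector_boundary_integral_def by metis
qed

text \<open>The polar coordinate map is continuous and so sends the closure of the parameter
  rectangle into the closure of its image.\<close>

lemma polar_in_closure:
  assumes "\<And>r t. 1 < r \<Longrightarrow> a < t \<Longrightarrow> t < b \<Longrightarrow> of_real r * cis t \<in> P" "a < b" "1 \<le> r" "a \<le> t" "t \<le> b"
  shows "of_real r * cis t \<in> closure P"
proof -
  have "(\<lambda>(r, t). of_real r * cis t) ` closure ({1<..} \<times> {a<..<b}) \<subseteq> closure P"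
    using assms(1) closure_subset[of P]
    by (intro image_closure_subset) (auto intro!: continuous_intros simp: case_prod_beta)
  moreover have "(r, t) \<in> closure ({1<..} \<times> {a<..<b})"
    using assms by (simp add: closure_Times)
  ultimately show ?thesis by force
qed

lemma Im_polar_cubed: "Im ((of_real r * cis t) ^ 3) = r ^ 3 * sin (3 * t)"
proof -
  have "(of_real r * cis t) ^ 3 = of_real (r ^ 3) * cis (3 * t)"
    by (simp add: power_mult_distrib Complex.DeMoivre)
  then show ?thesis by (simp only:) simp
qed

lemma open_Gamma_domains:
  "open {z. Im z > 0 \<and> Im (z ^ 3) > 0 \<and> norm z > 1}" "open {z. Im z < 0 \<and> Im (z ^ 3) > 0 \<and> norm z > 1}"
  by (intro open_Collect_conj open_Collect_less continuous_intros)+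

text \<open>The frontier of an open set is its closure minus the set. The point is a limit of points
  of the open sector and violates a strict inequality: its modulus is 1 or the sine of 3t is
  0.\<close>

lemma in_Gamma_plus:
  assumes "1 \<le> r" "a = 0 \<and> b = pi / 3 \<or> a = 2 * pi / 3 \<and> b = pi" "a \<le> t" "t \<le> b" "r = 1 \<or> t = a \<or> t = b"
  shows "of_real r * cis t \<in> Gamma_plus"
proof -
  let ?P = "{z. Im z > 0 \<and> Im (z ^ 3) > 0 \<and> norm z > 1}"
  have "of_real s * cis u \<in> ?P" if "1 < s" "a < u" "u < b" for s u
  proof -
    have "0 < sin (3 * u)"
    proof (cases "a = 0")
      case True
      then show ?thesis using assms(2) that by (intro sin_gt_zero) auto
    next
      case False
      then have "0 < sin (3 * u - 2 * pi)" using assms(2) that by (intro sin_gt_zero) auto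
      then show ?thesis using sin_periodic[of "3 * u - 2 * pi"] by simp
    qed
    moreover have "0 < sin u" using assms(2) that by (intro sin_gt_zero) auto
    ultimately show ?thesis using that by (simp add: Im_polar_cubed norm_mult del: Im_power_real)
  qed
  moreover have "a < b" using assms(2) pi_gt_zero by (elim disjE conjE; linarith)
  ultimately have "of_real r * cis t \<in> closure ?P"
    using assms by (intro polar_in_closure[where a = a and b = b])
  moreover have "of_real r * cis t \<notin> ?P"
  proof (cases "r = 1")
    case False
    then have "3 * t = 0 \<or> 3 * t = pi \<or> 3 * t = 2 * pi \<or> 3 * t = 3 * pi" using assms(2,5) by auto
    moreover have "sin (3 * pi) = 0" using sin_npi[of 3] by simp
    ultimately have "sin (3 * t) = 0" by auto
    then show ?thesis by (simp add: Im_polar_cubed)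
  qed (simp add: norm_mult)
  ultimately show ?thesis
    unfolding Gamma_plus_def frontier_def interior_open[OF open_Gamma_domains(1)] by blast
qed

text \<open>The other contours are excluded because \<open>functional\<close> tests for them first.
  \<open>Gamma_plus\<close> lies in the closed upper half-plane and \<open>Gamma0\<close> has radius
  1/2.\<close>

lemma in_Gamma_minus:
  assumes "1 \<le> r" "4 * pi / 3 \<le> t" "t \<le> 5 * pi / 3" "r = 1 \<or> t = 4 * pi / 3 \<or> t = 5 * pi / 3"
  shows "of_real r * cis t \<in> Gamma_minus - (Gamma_plus \<union> Gamma0)"
proof -
  let ?P = "{z. Im z < 0 \<and> Im (z ^ 3) > 0 \<and> norm z > 1}"
  have "of_real s * cis u \<in> ?P" if "1 < s" "4 * pi / 3 < u" "u < 5 * pi / 3" for s u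
  proof -
    have "0 < sin (3 * u - 4 * pi)" using that by (intro sin_gt_zero) auto
    then have "0 < sin (3 * u)" 
      using sin_periodic[of "3 * u - 4 * pi"] sin_periodic[of "3 * u - 2 * pi"] by simp
    moreover have "sin u < 0" using that by (intro sin_lt_zero) auto
    ultimately show ?thesis using that by (simp add: Im_polar_cubed norm_mult mult_pos_neg)
  qed
  then have "of_real r * cis t \<in> closure ?P"
    by (rule polar_in_closure[where a = "4 * pi / 3" and b = "5 * pi / 3"]) (use assms in auto)
  moreover have "of_real r * cis t \<notin> ?P"
  proof (cases "r = 1")
    case False
    then have "3 * t = real 4 * pi \<or> 3 * t = real 5 * pi" using assms(4) by auto
    then have "sin (3 * t) = 0" using sin_npi by metis
    then show ?thesis by (simp add: Im_polar_cubed)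
  qed (simp add: norm_mult)
  ultimately have "of_real r * cis t \<in> Gamma_minus"
    unfolding Gamma_minus_def frontier_def interior_open[OF open_Gamma_domains(2)] by blast
  moreover have "Gamma_plus \<subseteq> {z. 0 \<le> Im z}"
  proof -
    have "closure {z. Im z > 0 \<and> Im (z ^ 3) > 0 \<and> norm z > 1} \<subseteq> {z. 0 \<le> Im z}"
      by (intro closure_minimal closed_halfspace_Im_ge) auto
    then show ?thesis unfolding Gamma_plus_def frontier_def by blast
  qed
  moreover have "Im (of_real r * cis t) < 0"
  proof -
    have "pi < t" "t < 2 * pi" using assms(2,3) pi_gt_zero by linarith+
    then show ?thesis using assms(1) by (simp add: sin_lt_zero mult_pos_neg)
  qed
  moreover have "of_real r * cis t \<notin> Gamma0"
    using assms(1) by (simp add: Gamma0_def norm_mult)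
  ultimately show ?thesis by auto
qed

section \<open>Inversion\<close>

text \<open>The exponential growth \<open>E\<close> of the numerator cancels against that of the
  denominator; only the algebraic decay \<open>Q\<close> is left.\<close>

lemma norm_quotient_bound:
  fixes w s d :: complex
  assumes "norm w \<le> 1" "E / 8 \<le> norm d" "0 < E" "norm s \<le> E * Q"
  shows "norm (w * (s / (2 * of_real pi * d))) \<le> 8 * Q"
proof -
  have Q: "0 \<le> Q" using order_trans[OF norm_ge_zero assms(4)] assms(3) by (simp add: zero_le_mult_iff)
  have d: "0 < norm d" using assms(2,3) by (auto intro: less_le_trans[of 0 "E / 8"])
  have "norm (w * (s / (2 * of_real pi * d))) = norm w * (norm s / (2 * pi * norm d))"
    by (simp add: norm_mult norm_divide)
  also have "\<dots> \<le> 1 * (norm s / (1 * norm d))"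
    using assms(1) d pi_ge_two by (intro mult_mono divide_left_mono mult_right_mono) auto
  also have "\<dots> \<le> E * Q / (E / 8)"
    using assms d Q by (simp only: mult_1) (intro frac_le, auto)
  also have "\<dots> = 8 * Q" using assms(3) by simp
  finally show ?thesis .
qed

text \<open>The problems enter through \<open>D\<close>, \<open>Sp\<close> and \<open>Sm\<close>
  alone. In the rotated sectors growth is measured at \<open>alpha * z\<close> or
  \<open>alpha^2 * z\<close>, since by symmetry |D| takes the same value there and the lower bound
  applies.\<close>

lemma has_inverse_transform_functional:
  fixes D Sp Sm :: "complex \<Rightarrow> complex" and f :: "real \<Rightarrow> complex"
  assumes f: "smooth01 f" "f 0 = 0" "f 1 = 0" and x: "0 < x" "x < 1"
    and hol: "D holomorphic_on UNIV" "Sp holomorphic_on UNIV" "Sm holomorphic_on UNIV"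
    and D_disc: "\<And>z. z \<noteq> 0 \<Longrightarrow> norm z \<le> 2 \<Longrightarrow> D z \<noteq> 0"
    and D_sector: "\<And>z. z \<in> sector \<Longrightarrow> 2 \<le> norm z \<Longrightarrow> exp (Im z) / 8 \<le> norm (D z)"
    and D_alpha: "\<And>z. D (alpha * z) = alpha^2 * D z"
    and \<phi>p: "\<And>z. integral {0..1} (\<lambda>t. \<phi>p t z * f t) = Sp z / (2 * of_real pi * D z)"
    and \<phi>m: "\<And>z. integral {0..1} (\<lambda>t. \<phi>m t z * f t) = - exp (- \<i> * z) * (Sm z / (2 * of_real pi * D z))"
    and jump: "\<And>z. Sp z + exp (- \<i> * z) * Sm z = D z * fourier f 0 1 z"
    and B: "0 \<le> B"
    and bp: "\<And>z. z \<in> sector \<Longrightarrow> 2 \<le> norm z \<Longrightarrow> norm (Sp z) \<le> exp (Im z) * (B / norm z ^ 2)"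
    and bm1: "\<And>z. alpha * z \<in> sector \<Longrightarrow> 2 \<le> norm z \<Longrightarrow> norm (Sm z) \<le> exp (Im (alpha * z)) * (B / norm z ^ 2)"
    and bm2: "\<And>z. alpha^2 * z \<in> sector \<Longrightarrow> 2 \<le> norm z \<Longrightarrow> norm (Sm z) \<le> exp (Im (alpha^2 * z)) * (B / norm z ^ 2)"
  shows "has_inverse_transform (functional \<phi>p \<phi>m f) x (f x)"
proof -
  have contf: "continuous_on {0..1} f" using smooth01_derivs(3)[OF f(1)] .
  obtain K where K: "0 \<le> K" "\<And>a b z E. \<lbrakk>0 \<le> a; a \<le> b; b \<le> 1; z \<noteq> 0; \<And>t. t \<in> {a..b} \<Longrightarrow> exp (t * Im z) \<le> E\<rbrakk> \<Longrightarrow>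
      norm (fourier f a b z - (exp (- \<i> * z * of_real a) * f a - exp (- \<i> * z * of_real b) * f b) / (\<i> * z))
          \<le> K * E / norm z ^ 2"
    by (rule fourier_bound[OF f(1)]) blast
  define C where "C = 8 * B + K"
  define U where "U = {z. D z \<noteq> 0}"
  define gp where "gp = (\<lambda>z. exp (\<i> * z * of_real x) * (Sp z / (2 * of_real pi * D z)))"
  define gm where "gm = (\<lambda>z. exp (\<i> * z * of_real x) * (- exp (- \<i> * z) * (Sm z / (2 * of_real pi * D z))))"
  define h1 where "h1 = (\<lambda>z. exp (\<i> * z * of_real x) * fourier f 0 x z / (2 * of_real pi))"
  define h2 where "h2 = (\<lambda>z. exp (\<i> * z * of_real x) * fourier f x 1 z / (2 * of_real pi))"
  define c where "c = f x / (2 * of_real pi * \<i>)"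
  have D_sector_nz: "D z \<noteq> 0" if "z \<in> sector" for z
  proof (cases "norm z \<le> 2")
    case True
    have "z \<noteq> 0" using that by (auto simp: sector_def)
    then show ?thesis using D_disc True by simp
  next
    case False
    then have "0 < norm (D z)" using D_sector[OF that] less_le_trans[of 0 "exp (Im z) / 8" "norm (D z)"] by simp
    then show ?thesis by simp
  qed
  have D_alpha2: "D (alpha^2 * z) = alpha * D z" for z
  proof -
    have "D (alpha * (alpha * z)) = alpha^2 * (alpha^2 * D z)" by (simp only: D_alpha)
    then show ?thesis by (simp only: alpha_mult)
  qed
  \<comment> \<open>The two exponential prefactors together have modulus exp((1 - x) * Im z), at
    most 1 in the lower half-plane because x < 1.\<close>
  have decay: "norm (gm z) \<le> C / norm z ^ 2"
    if "Im z \<le> 0" "exp (Im w) / 8 \<le> norm (D z)" "norm (Sm z) \<le> exp (Im w) * (B / norm z ^ 2)" for z w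
  proof -
    have "exp (Im z * (1 - x)) \<le> 1" using that x by (simp add: mult_nonpos_nonneg)
    then have "norm (- (exp (\<i> * z * of_real x) * exp (- \<i> * z))) \<le> 1"
      by (simp add: norm_mult algebra_simps flip: exp_add)
    from norm_quotient_bound[OF this that(2) _ that(3)]
    have "norm (gm z) \<le> 8 * (B / norm z ^ 2)" by (simp add: gm_def mult.assoc)
    also have "\<dots> \<le> C / norm z ^ 2"
      using K(1) by (simp add: C_def divide_right_mono add_divide_distrib)
    finally show ?thesis .
  qed
  \<comment> \<open>The decay of exp(izx) exactly offsets the growth exp(x * Im z) of the partial
    transform.\<close>
  have half: "norm (exp (\<i> * z * of_real x) * w / (2 * of_real pi)) \<le> C / norm z ^ 2"
    if "norm w \<le> K * exp (x * Im z) / norm z ^ 2" for z w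
  proof -
    have "norm (exp (\<i> * z * of_real x) * w / (2 * of_real pi)) = exp (- (x * Im z)) * norm w / (2 * pi)"
      by (simp add: norm_mult norm_divide mult.commute)
    also have "\<dots> \<le> exp (- (x * Im z)) * norm w / 1"
      using pi_ge_two by (intro divide_left_mono) auto
    also have "\<dots> \<le> exp (- (x * Im z)) * (K * exp (x * Im z) / norm z ^ 2)"
      unfolding div_by_1 by (intro mult_left_mono that) simp
    also have "\<dots> = K / norm z ^ 2" by (simp add: exp_minus field_simps)
    also have "\<dots> \<le> C / norm z ^ 2" using B by (simp add: C_def divide_right_mono)
    finally show ?thesis .
  qed
  have "\<exists>I0 Ip Iq. (gp has_contour_integral I0) (circlepath 0 (1/2)) \<and> has_Gamma_plus_integral gp Ip \<and>
           has_Gamma_minus_integral gm Iq \<and> 2 * of_real pi * \<i> * c = I0 + Ip + Iq"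
  proof (rule contour_deformation[where U = U and ?h1.0 = h1 and ?h2.0 = h2 and C = C])
    have "continuous_on UNIV D" using hol(1) by (rule holomorphic_on_imp_continuous_on)
    then show "open U" unfolding U_def by (intro open_Collect_neq continuous_on_const)
    have "S holomorphic_on UNIV \<Longrightarrow> S holomorphic_on U" for S
      by (rule holomorphic_on_subset) auto
    note holU = this[OF hol(1)] this[OF hol(2)] this[OF hol(3)]
    show "gp holomorphic_on U" "gm holomorphic_on U"
      unfolding gp_def gm_def by (intro holomorphic_intros holU; simp add: U_def)+
    show "h1 holomorphic_on UNIV" "h2 holomorphic_on UNIV"
      unfolding h1_def h2_def using x
      by (intro holomorphic_intros holomorphic_fourier continuous_on_subset[OF contf]; simp)+
    show "gp z = gm z + (h1 z + h2 z)" if "z \<in> U" for z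
    proof -
      have *: "Sp z / (2 * of_real pi * D z) = - exp (- \<i> * z) * (Sm z / (2 * of_real pi * D z)) + fourier f 0 1 z / (2 * of_real pi)"
        using jump[of z] that by (simp add: U_def field_simps)
      show ?thesis
        using fourier_combine[OF contf, of x z] x
        unfolding gp_def gm_def h1_def h2_def * by (simp add: distrib_left right_diff_distrib add_divide_distrib)
    qed
    show "ball 0 2 - {0} \<subseteq> U" using D_disc by (auto simp: U_def)
    show "sector \<subseteq> U" using D_sector_nz by (auto simp: U_def)
    show "{z. alpha * z \<in> sector} \<subseteq> U" "{z. alpha^2 * z \<in> sector} \<subseteq> U"
      using D_sector_nz D_alpha D_alpha2 by (force simp: U_def)+
    show "norm (gp z) \<le> C / norm z ^ 2" if "z \<in> sector" "2 \<le> norm z" for z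
    proof -
      have "norm (exp (\<i> * z * of_real x)) \<le> 1"
        using that x by (simp add: sector_def)
      from norm_quotient_bound[OF this D_sector[OF that] _ bp[OF that]]
      have "norm (gp z) \<le> 8 * (B / norm z ^ 2)" by (simp add: gp_def)
      also have "\<dots> \<le> C / norm z ^ 2"
        using K(1) by (simp add: C_def divide_right_mono add_divide_distrib)
      finally show ?thesis .
    qed
    show "norm (gm z) \<le> C / norm z ^ 2" if "alpha * z \<in> sector" "2 \<le> norm z" for z
    proof (rule decay[OF _ _ bm1[OF that]])
      \<comment> \<open>One of the sector inequalities at \<open>alpha * z\<close> concerns
        \<open>alpha^2 * (alpha * z)\<close>, which is \<open>z\<close>.\<close>
      show "Im z \<le> 0" using that alpha_mult(3)[of z] by (simp add: sector_def del: times_complex.sel)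
      show "exp (Im (alpha * z)) / 8 \<le> norm (D z)"
        using D_sector[OF that(1)] that(2) by (simp add: D_alpha norm_mult norm_power del: times_complex.sel)
    qed
    show "norm (gm z) \<le> C / norm z ^ 2" if "alpha^2 * z \<in> sector" "2 \<le> norm z" for z
    proof (rule decay[OF _ _ bm2[OF that]])
      show "Im z \<le> 0" using that alpha_mult(2)[of z] by (simp add: sector_def del: times_complex.sel)
      show "exp (Im (alpha^2 * z)) / 8 \<le> norm (D z)"
        using D_sector[OF that(1)] that(2) by (simp add: D_alpha2 norm_mult norm_power del: times_complex.sel)
    qed
    have e: "exp (\<i> * z * of_real x) * (exp (- \<i> * z * of_real x) * w) = w" for z w
      by (simp add: exp_minus)
    show "norm (h1 z + c / z) \<le> C / norm z ^ 2" if "0 \<le> Im z" "2 \<le> norm z" for z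
    proof -
      have z: "z \<noteq> 0" using that by auto
      \<comment> \<open>For t in [0,x] and Im z \<ge> 0 the exponential is largest at t = x. The
        boundary term at 0 vanishes, leaving only the one at \<open>x\<close>.\<close>
      have "norm (fourier f 0 x z + exp (- \<i> * z * of_real x) * (f x / (\<i> * z))) \<le> K * exp (x * Im z) / norm z ^ 2"
        using K(2)[of 0 x z "exp (x * Im z)"] x z that by (simp add: f mult_right_mono)
      from half[OF this] show ?thesis
        by (simp only: distrib_left e) (simp add: h1_def c_def add_divide_distrib mult_ac)
    qed
    show "norm (h2 z - c / z) \<le> C / norm z ^ 2" if "Im z \<le> 0" "2 \<le> norm z" for z
    proof -
      have z: "z \<noteq> 0" using that by auto
      \<comment> \<open>In the lower half-plane the exponential over [x,1] is again largest at t =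
        x, and the boundary term at 1 vanishes.\<close>
      have "norm (fourier f x 1 z - exp (- \<i> * z * of_real x) * (f x / (\<i> * z))) \<le> K * exp (x * Im z) / norm z ^ 2"
        using K(2)[of x 1 z "exp (x * Im z)"] x z that by (simp add: f mult_right_mono_neg)
      from half[OF this] show ?thesis
        by (simp only: right_diff_distrib e) (simp add: h2_def c_def diff_divide_distrib mult_ac)
    qed
  qed
  then obtain I0 Ip Iq where I: "(gp has_contour_integral I0) (circlepath 0 (1/2))" "has_Gamma_plus_integral gp Ip"
      "has_Gamma_minus_integral gm Iq" "f x = I0 + Ip + Iq"
    by (auto simp: c_def)
  define g where "g = (\<lambda>z. exp (\<i> * z * of_real x) * functional \<phi>p \<phi>m f z)"
  have gp: "gp z = g z" if "z \<in> Gamma_plus \<union> Gamma0" for z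
    using that by (simp add: g_def gp_def functional_def \<phi>p)
  have gm: "gm z = g z" if "z \<in> Gamma_minus - (Gamma_plus \<union> Gamma0)" for z
    using that by (simp add: g_def gm_def functional_def \<phi>m)
  have "(g has_contour_integral I0) (circlepath 0 (1/2))"
    using I(1) by (rule has_contour_integral_eq) (auto intro!: gp simp: Gamma0_def)
  moreover have "has_Gamma_plus_integral g Ip"
  proof -
    have cong: "has_sector_boundary_integral g a b I" if "has_sector_boundary_integral gp a b I" "a = 0 \<and> b = pi / 3 \<or> a = 2 * pi / 3 \<and> b = pi" for a b I
    proof (rule has_sector_boundary_integral_cong[OF that(1)])
      show "a \<le> b" using that(2) pi_gt_zero by (elim disjE conjE; linarith)
      then show "gp (of_real r * cis a) = g (of_real r * cis a)" "gp (of_real r * cis b) = g (of_real r * cis b)" if "1 \<le> r" for r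
        using in_Gamma_plus[OF that \<open>a = 0 \<and> b = pi / 3 \<or> a = 2 * pi / 3 \<and> b = pi\<close>] by (simp_all add: gp)
      show "gp (cis t) = g (cis t)" if "a \<le> t" "t \<le> b" for t
        using in_Gamma_plus[of 1 a b t] that \<open>a = 0 \<and> b = pi / 3 \<or> a = 2 * pi / 3 \<and> b = pi\<close> by (simp add: gp)
    qed
    show ?thesis
      using I(2) cong unfolding has_Gamma_plus_integral_def by blast
  qed
  moreover have "has_Gamma_minus_integral g Iq"
    using I(3) unfolding has_Gamma_minus_integral_def
  proof (rule has_sector_boundary_integral_cong)
    show "gm (of_real r * cis (4 * pi / 3)) = g (of_real r * cis (4 * pi / 3))"
         "gm (of_real r * cis (5 * pi / 3)) = g (of_real r * cis (5 * pi / 3))" if "1 \<le> r" for r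
      using that by (intro gm in_Gamma_minus; simp)+
    show "gm (cis t) = g (cis t)" if "4 * pi / 3 \<le> t" "t \<le> 5 * pi / 3" for t
      using in_Gamma_minus[of 1 t] that by (simp add: gm)
  qed simp
  ultimately show ?thesis
    using I(4) unfolding has_inverse_transform_def g_def Let_def by blast
qed

section \<open>Estimates and identities shared by the two problems\<close>

lemma sector_norms:
  assumes "z \<in> sector"
  shows "norm (exp (- \<i> * z)) = exp (Im z)" "norm (exp (\<i> * z)) \<le> 1"
    "norm (exp (- \<i> * alpha * z)) \<le> 1" "norm (exp (- \<i> * alpha^2 * z)) \<le> 1"
    "norm (exp (\<i> * alpha * z)) \<le> exp (Im z)" "norm (exp (\<i> * alpha^2 * z)) \<le> exp (Im z)" "1 \<le> exp (Im z)"
  using assms Im_alpha_sum[of z] by (simp_all add: sector_def mult.assoc del: times_complex.sel)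

text \<open>The sector lies in the upper half-plane, while both of its rotations lie in the lower
  one, where the transform does not grow.\<close>

lemma fourier_decay_sector:
  assumes "smooth01 f" "f 0 = 0" "f 1 = 0"
  obtains K where "0 \<le> K"
    "\<And>w. w \<in> sector \<Longrightarrow> norm (fourier f 0 1 w) \<le> exp (Im w) * (K / norm w ^ 2)"
    "\<And>w. w \<in> sector \<Longrightarrow> norm (fourier f 0 1 (alpha * w)) \<le> K / norm w ^ 2"
    "\<And>w. w \<in> sector \<Longrightarrow> norm (fourier f 0 1 (alpha^2 * w)) \<le> K / norm w ^ 2"
proof -
  obtain K where K: "0 \<le> K" "\<And>z. z \<noteq> 0 \<Longrightarrow> Im z \<le> 0 \<Longrightarrow> norm (fourier f 0 1 z) \<le> K / norm z ^ 2"
    "\<And>z. z \<noteq> 0 \<Longrightarrow> 0 \<le> Im z \<Longrightarrow> norm (fourier f 0 1 z) \<le> exp (Im z) * (K / norm z ^ 2)"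
    by (rule fourier_decay[OF assms]) blast
  show ?thesis
  proof (rule that[OF K(1)])
    fix w assume w: "w \<in> sector"
    have "w \<noteq> 0" "alpha \<noteq> 0" using w norm_alpha by (auto simp: sector_def simp del: norm_alpha)
    then show "norm (fourier f 0 1 w) \<le> exp (Im w) * (K / norm w ^ 2)"
      "norm (fourier f 0 1 (alpha * w)) \<le> K / norm w ^ 2"
      "norm (fourier f 0 1 (alpha^2 * w)) \<le> K / norm w ^ 2"
      using K(3)[of w] K(2)[of "alpha * w"] K(2)[of "alpha^2 * w"] w
      by (simp_all add: sector_def norm_mult norm_power del: times_complex.sel)
  qed
qed

lemma integral_fourier_combination:
  assumes "continuous_on {0..1} f"
  shows "integral {0..1} (\<lambda>t. k * (exp (- \<i> * z * of_real t) * c0 + exp (- \<i> * alpha * z * of_real t) * c1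
            + exp (- \<i> * alpha^2 * z * of_real t) * c2) * f t)
       = k * (fourier f 0 1 z * c0 + fourier f 0 1 (alpha * z) * c1 + fourier f 0 1 (alpha^2 * z) * c2)"
proof -
  have F: "((\<lambda>t. exp (- \<i> * w * of_real t) * f t) has_integral fourier f 0 1 w) {0..1}" for w
    unfolding fourier_def using assms by (intro integrable_integral integrable_continuous_real continuous_intros)
  have "((\<lambda>t. k * (exp (- \<i> * z * of_real t) * f t * c0 + exp (- \<i> * (alpha * z) * of_real t) * f t * c1
            + exp (- \<i> * (alpha^2 * z) * of_real t) * f t * c2)) has_integral
       k * (fourier f 0 1 z * c0 + fourier f 0 1 (alpha * z) * c1 + fourier f 0 1 (alpha^2 * z) * c2)) {0..1}"
    by (intro has_integral_mult_right has_integral_add has_integral_mult_left F)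
  then show ?thesis
    by (intro integral_unique) (simp add: algebra_simps)
qed

text \<open>A consequence of 1 + alpha + alpha^2 = 0. It turns the mixed exponentials of Problem 1
  into the products that occur in the jump relation.\<close>

lemma exp_alpha_products:
  "exp (\<i> * alpha * z) = exp (- \<i> * z) * exp (- \<i> * alpha^2 * z)"
  "exp (\<i> * alpha^2 * z) = exp (- \<i> * z) * exp (- \<i> * alpha * z)"
proof -
  have "alpha * z = - z - alpha^2 * z" "alpha^2 * z = - z - alpha * z"
    using alpha_sum_mult[of z] by algebra+
  then have "\<i> * (alpha * z) = - \<i> * z + - \<i> * (alpha^2 * z)" "\<i> * (alpha^2 * z) = - \<i> * z + - \<i> * (alpha * z)"
    by (simp_all only:) (simp_all add: algebra_simps)
  then show "exp (\<i> * alpha * z) = exp (- \<i> * z) * exp (- \<i> * alpha^2 * z)"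
    "exp (\<i> * alpha^2 * z) = exp (- \<i> * z) * exp (- \<i> * alpha * z)"
    by (simp_all only: mult.assoc exp_add)
qed

lemma norm_mult_le: "norm a \<le> A \<Longrightarrow> norm b \<le> B \<Longrightarrow> norm (a * b) \<le> A * B" for a b :: complex
  unfolding norm_mult by (intro mult_mono) (auto intro: order_trans[OF norm_ge_zero])

lemma has_inverse_transform_F1:
  assumes f: "smooth01 f" "f 0 = 0" "f 1 = 0" and x: "0 < x" "x < 1"
  shows "has_inverse_transform (F1 f) x (f x)"
proof -
  have contf: "continuous_on {0..1} f" using smooth01_derivs(3)[OF f(1)] .
  obtain K where K: "0 \<le> K"
    and bnd: "\<And>w. w \<in> sector \<Longrightarrow> norm (fourier f 0 1 w) \<le> exp (Im w) * (K / norm w ^ 2)"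
    "\<And>w. w \<in> sector \<Longrightarrow> norm (fourier f 0 1 (alpha * w)) \<le> K / norm w ^ 2"
    "\<And>w. w \<in> sector \<Longrightarrow> norm (fourier f 0 1 (alpha^2 * w)) \<le> K / norm w ^ 2"
    by (rule fourier_decay_sector[OF f]) blast
  let ?F = "fourier f 0 1"
  define Sp where "Sp = (\<lambda>z. ?F z * (exp (\<i> * z) + 2 * alpha * exp (- \<i> * alpha * z) + 2 * alpha^2 * exp (- \<i> * alpha^2 * z))
     + ?F (alpha * z) * (alpha * exp (\<i> * alpha * z) - 2 * alpha * exp (- \<i> * z))
     + ?F (alpha^2 * z) * (alpha^2 * exp (\<i> * alpha^2 * z) - 2 * alpha^2 * exp (- \<i> * z)))"
  define Sm where "Sm = (\<lambda>z. ?F z * (2 + alpha^2 * exp (- \<i> * alpha * z) + alpha * exp (- \<i> * alpha^2 * z))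
      + ?F (alpha * z) * (alpha * (2 - exp (- \<i> * alpha^2 * z)))
      + ?F (alpha^2 * z) * (alpha^2 * (2 - exp (- \<i> * alpha * z))))"
  show ?thesis
    unfolding F1_def
  \<comment> \<open>The constant 11 is 5 + 3 + 3, the coefficient bounds of the three transforms in
    \<open>Sp\<close>; it also covers the estimate of \<open>Sm\<close>.\<close>
  proof (rule has_inverse_transform_functional[OF f x, where D = Delta1 and Sp = Sp and Sm = Sm and B = "11 * K"])
    have F: "(\<lambda>z. ?F (c * z)) holomorphic_on UNIV" for c
      using holomorphic_on_compose[OF holomorphic_on_mult[OF holomorphic_on_const holomorphic_on_ident] holomorphic_fourier[OF contf]]
      by (simp add: o_def)
    have F': "?F holomorphic_on UNIV" by (rule holomorphic_fourier[OF contf])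
    show "Delta1 holomorphic_on UNIV" "Sp holomorphic_on UNIV" "Sm holomorphic_on UNIV"
      unfolding Delta1_def Sp_def Sm_def by (intro holomorphic_intros F F')+
    show "Delta1 z \<noteq> 0" if "z \<noteq> 0" "norm z \<le> 2" for z using Delta1_nonzero_disc that .
    show "exp (Im z) / 8 \<le> norm (Delta1 z)" if "z \<in> sector" "2 \<le> norm z" for z using Delta1_lower_sector that .
    show "Delta1 (alpha * z) = alpha^2 * Delta1 z" for z by (rule Delta1_alpha)
    show "integral {0..1} (\<lambda>t. phi1_plus t z * f t) = Sp z / (2 * of_real pi * Delta1 z)" for z
      unfolding phi1_plus_def integral_fourier_combination[OF contf] Sp_def by simp
    show "integral {0..1} (\<lambda>t. phi1_minus t z * f t) = - exp (- \<i> * z) * (Sm z / (2 * of_real pi * Delta1 z))" for z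
    proof -
      have "phi1_minus t z = - exp (- \<i> * z) / (2 * of_real pi * Delta1 z) * (exp (- \<i> * z * of_real t) * (2 + alpha^2 * exp (- \<i> * alpha * z) + alpha * exp (- \<i> * alpha^2 * z))
          + exp (- \<i> * alpha * z * of_real t) * (alpha * (2 - exp (- \<i> * alpha^2 * z)))
          + exp (- \<i> * alpha^2 * z * of_real t) * (alpha^2 * (2 - exp (- \<i> * alpha * z))))" for t
        unfolding phi1_minus_def by (simp only: mult_ac)
      then show ?thesis
        by (simp only: integral_fourier_combination[OF contf] Sm_def) simp
    qed
    show "Sp z + exp (- \<i> * z) * Sm z = Delta1 z * ?F z" for z
      unfolding Sp_def Sm_def Delta1_def exp_alpha_products by (simp add: algebra_simps)
    show "0 \<le> 11 * K" using K by simp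
    show "norm (Sp z) \<le> exp (Im z) * (11 * K / norm z ^ 2)" if z: "z \<in> sector" for z
    proof -
      note n = sector_norms[OF z]
      have "norm (Sp z) \<le> exp (Im z) * (K / norm z ^ 2) * (1 + 2 * 1 + 2 * 1)
          + K / norm z ^ 2 * (exp (Im z) + 2 * exp (Im z)) + K / norm z ^ 2 * (exp (Im z) + 2 * exp (Im z))"
        unfolding Sp_def
        by (intro norm_triangle_le norm_triangle_le_diff add_mono norm_mult_le bnd[OF z])
           (use n in \<open>simp_all add: norm_mult norm_power\<close>)
      also have "\<dots> = exp (Im z) * (11 * K / norm z ^ 2)" by (simp add: algebra_simps)
      finally show ?thesis .
    qed
    \<comment> \<open>Here \<open>p\<close> and \<open>q\<close> measure the growth at
      \<open>alpha * z\<close> and \<open>alpha^2 * z\<close>. In each rotated sector one of them is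
      \<open>E\<close> and the other 1, so the product \<open>p * q\<close> is only
      \<open>E\<close>, not its square.\<close>
    have Sm: "norm (Sm z) \<le> E * (11 * K / norm z ^ 2)"
      if "norm (?F z) \<le> K / norm z ^ 2" "1 \<le> E"
        "norm (?F (alpha * z)) \<le> p * (K / norm z ^ 2)" "norm (?F (alpha^2 * z)) \<le> q * (K / norm z ^ 2)"
        "norm (exp (- \<i> * alpha * z)) \<le> p" "norm (exp (- \<i> * alpha^2 * z)) \<le> q" "p = E \<and> q = 1 \<or> p = 1 \<and> q = E" for z E p q
    proof -
      have "norm (Sm z) \<le> K / norm z ^ 2 * (2 + p + q) + p * (K / norm z ^ 2) * (1 * (2 + q)) + q * (K / norm z ^ 2) * (1 * (2 + p))"
        unfolding Sm_def
        by (intro norm_triangle_le norm_triangle_le_diff add_mono norm_mult_le that)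
           (use that(5,6) in \<open>simp_all add: norm_mult norm_power\<close>)
      also have "\<dots> = (K / norm z ^ 2) * (2 + 3 * p + 3 * q + 2 * (p * q))"
        by (simp add: algebra_simps add_divide_distrib)
      also have "\<dots> \<le> (K / norm z ^ 2) * (11 * E)"
        using that(2,7) K by (intro mult_left_mono) auto
      finally show ?thesis by (simp add: mult_ac)
    qed
    show "norm (Sm z) \<le> exp (Im (alpha * z)) * (11 * K / norm z ^ 2)" if z: "alpha * z \<in> sector" for z
      using sector_norms[OF z] bnd[OF z]
      by (intro Sm[where p = "exp (Im (alpha * z))" and q = 1]) (simp_all add: norm_mult mult.assoc del: times_complex.sel)
    show "norm (Sm z) \<le> exp (Im (alpha^2 * z)) * (11 * K / norm z ^ 2)" if z: "alpha^2 * z \<in> sector" for z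
      using sector_norms[OF z, unfolded mult.assoc alpha_mult] bnd[OF z, unfolded alpha_mult]
      by (intro Sm[where q = "exp (Im (alpha^2 * z))" and p = 1]) (simp_all add: norm_mult norm_power mult.assoc del: times_complex.sel)
  qed
qed

lemma has_inverse_transform_F2:
  assumes f: "smooth01 f" "f 0 = 0" "f 1 = 0" and x: "0 < x" "x < 1"
  shows "has_inverse_transform (F2 f) x (f x)"
proof -
  have contf: "continuous_on {0..1} f" using smooth01_derivs(3)[OF f(1)] .
  obtain K where K: "0 \<le> K"
    and bnd: "\<And>w. w \<in> sector \<Longrightarrow> norm (fourier f 0 1 w) \<le> exp (Im w) * (K / norm w ^ 2)"
    "\<And>w. w \<in> sector \<Longrightarrow> norm (fourier f 0 1 (alpha * w)) \<le> K / norm w ^ 2"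
    "\<And>w. w \<in> sector \<Longrightarrow> norm (fourier f 0 1 (alpha^2 * w)) \<le> K / norm w ^ 2"
    by (rule fourier_decay_sector[OF f]) blast
  let ?F = "fourier f 0 1"
  define Sp where "Sp = (\<lambda>z. ?F z * (alpha * exp (- \<i> * alpha * z) + alpha^2 * exp (- \<i> * alpha^2 * z))
     + ?F (alpha * z) * (- alpha * exp (- \<i> * z))
     + ?F (alpha^2 * z) * (- (alpha^2) * exp (- \<i> * z)))"
  define Sm where "Sm = (\<lambda>z. ?F z * 1 + ?F (alpha * z) * alpha + ?F (alpha^2 * z) * alpha^2)"
  show ?thesis
    unfolding F2_def
  \<comment> \<open>The constant 4 is 2 + 1 + 1 from the three terms of \<open>Sp\<close>; it also
    dominates 1 + 2E for \<open>Sm\<close>.\<close>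
  proof (rule has_inverse_transform_functional[OF f x, where D = Delta2 and Sp = Sp and Sm = Sm and B = "4 * K"])
    have F: "(\<lambda>z. ?F (c * z)) holomorphic_on UNIV" for c
      using holomorphic_on_compose[OF holomorphic_on_mult[OF holomorphic_on_const holomorphic_on_ident] holomorphic_fourier[OF contf]]
      by (simp add: o_def)
    have F': "?F holomorphic_on UNIV" by (rule holomorphic_fourier[OF contf])
    show "Delta2 holomorphic_on UNIV" "Sp holomorphic_on UNIV" "Sm holomorphic_on UNIV"
      unfolding Delta2_def Sp_def Sm_def by (intro holomorphic_intros F F')+
    show "Delta2 z \<noteq> 0" if "z \<noteq> 0" "norm z \<le> 2" for z using Delta2_nonzero_disc that .
    show "exp (Im z) / 8 \<le> norm (Delta2 z)" if "z \<in> sector" "2 \<le> norm z" for z using Delta2_lower_sector that .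
    show "Delta2 (alpha * z) = alpha^2 * Delta2 z" for z by (rule Delta2_alpha)
    show "integral {0..1} (\<lambda>t. phi2_plus t z * f t) = Sp z / (2 * of_real pi * Delta2 z)" for z
    proof -
      have "phi2_plus t z = 1 / (2 * of_real pi * Delta2 z) * (exp (- \<i> * z * of_real t) * (alpha * exp (- \<i> * alpha * z) + alpha^2 * exp (- \<i> * alpha^2 * z))
          + exp (- \<i> * alpha * z * of_real t) * (- alpha * exp (- \<i> * z))
          + exp (- \<i> * alpha^2 * z * of_real t) * (- (alpha^2) * exp (- \<i> * z)))" for t
        unfolding phi2_plus_def by (rule arg_cong[of _ _ "(*) _"]) (simp add: algebra_simps)
      then show ?thesis
        by (simp only: integral_fourier_combination[OF contf] Sp_def) simp
    qed
    show "integral {0..1} (\<lambda>t. phi2_minus t z * f t) = - exp (- \<i> * z) * (Sm z / (2 * of_real pi * Delta2 z))" for z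
    proof -
      have "phi2_minus t z = - exp (- \<i> * z) / (2 * of_real pi * Delta2 z) * (exp (- \<i> * z * of_real t) * 1
          + exp (- \<i> * alpha * z * of_real t) * alpha + exp (- \<i> * alpha^2 * z * of_real t) * alpha^2)" for t
        unfolding phi2_minus_def by (simp only: mult_ac mult_1_left mult_1_right)
      then show ?thesis
        by (simp only: integral_fourier_combination[OF contf] Sm_def) simp
    qed
    show "Sp z + exp (- \<i> * z) * Sm z = Delta2 z * ?F z" for z
      unfolding Sp_def Sm_def Delta2_def by (simp add: algebra_simps)
    show "0 \<le> 4 * K" using K by simp
    show "norm (Sp z) \<le> exp (Im z) * (4 * K / norm z ^ 2)" if z: "z \<in> sector" for z
    proof -
      note n = sector_norms[OF z]
      have "norm (Sp z) \<le> exp (Im z) * (K / norm z ^ 2) * (1 + 1)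
          + K / norm z ^ 2 * exp (Im z) + K / norm z ^ 2 * exp (Im z)"
        unfolding Sp_def
        by (intro norm_triangle_le add_mono norm_mult_le bnd[OF z])
           (use n in \<open>simp_all add: norm_mult norm_power\<close>)
      also have "\<dots> = exp (Im z) * (4 * K / norm z ^ 2)" by (simp add: algebra_simps)
      finally show ?thesis .
    qed
    have Sm: "norm (Sm z) \<le> E * (4 * K / norm z ^ 2)"
      if "norm (?F z) \<le> K / norm z ^ 2" "1 \<le> E"
        "norm (?F (alpha * z)) \<le> E * (K / norm z ^ 2)" "norm (?F (alpha^2 * z)) \<le> E * (K / norm z ^ 2)" for z E
    proof -
      have "norm (Sm z) \<le> K / norm z ^ 2 * 1 + E * (K / norm z ^ 2) * 1 + E * (K / norm z ^ 2) * 1"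
        unfolding Sm_def
        by (intro norm_triangle_le add_mono norm_mult_le that) (simp_all add: norm_power)
      also have "\<dots> = (K / norm z ^ 2) * (1 + 2 * E)"
        by (simp add: algebra_simps add_divide_distrib)
      also have "\<dots> \<le> (K / norm z ^ 2) * (4 * E)"
        using that(2) K by (intro mult_left_mono) auto
      finally show ?thesis by (simp add: mult_ac)
    qed
    \<comment> \<open>Weakening the bound on the non-growing transform by the factor
      \<open>E\<close> lets one estimate of \<open>Sm\<close> serve both rotated sectors.\<close>
    have grow: "s \<le> E * Q" if "s \<le> Q" "1 \<le> E" "0 \<le> Q" for s E Q :: real
      using mult_right_mono[OF that(2,3)] that(1) by simp
    have Q: "0 \<le> K / norm z ^ 2" for z :: complex using K by simp
    show "norm (Sm z) \<le> exp (Im (alpha * z)) * (4 * K / norm z ^ 2)" if z: "alpha * z \<in> sector" for z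
    proof -
      note b = bnd[OF z, unfolded alpha_mult norm_mult norm_alpha mult_1]
      show ?thesis by (rule Sm[OF b(3) _ b(1) grow[OF b(2) _ Q]]; rule sector_norms(7)[OF z])
    qed
    show "norm (Sm z) \<le> exp (Im (alpha^2 * z)) * (4 * K / norm z ^ 2)" if z: "alpha^2 * z \<in> sector" for z
    proof -
      note b = bnd[OF z, unfolded alpha_mult norm_mult norm_power norm_alpha power_one mult_1]
      show ?thesis by (rule Sm[OF b(2) _ grow[OF b(3) _ Q] b(1)]; rule sector_norms(7)[OF z])
    qed
  qed
qed

theorem proposition2p1:
  shows "(\<forall>f :: real \<Rightarrow> complex.
            smooth01 f \<and> f 0 = 0 \<and> f 1 = 0 \<and> deriv01 f 0 = 2 * deriv01 f 1 \<longrightarrow>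
            (\<forall>x::real. 0 < x \<and> x < 1 \<longrightarrow> has_inverse_transform (F1 f) x (f x)))
       \<and> (\<forall>f :: real \<Rightarrow> complex.
            smooth01 f \<and> f 0 = 0 \<and> f 1 = 0 \<and> deriv01 f 1 = 0 \<longrightarrow>
            (\<forall>x::real. 0 < x \<and> x < 1 \<longrightarrow> has_inverse_transform (F2 f) x (f x)))"
  using has_inverse_transform_F1 has_inverse_transform_F2 by blast

end
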